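(* Let $a<-l<0<l<b$, $L_1=-l-a$, $L_2=b-l$, $L=\max\{L_1,L_2\}$. Assume the following. (1) $\mathcal F_1\colon(a,-l)\times\mathbb R\to\mathbb R$ and there exist $m_1>0$, $M_1>0$ such that, for all $r,s\in\mathbb R$ and a.e. $x\in(a,-l)$: $(\mathcal F_1(x,r)-\mathcal F_1(x,s))(r-s)\ge m_1|r-s|^2$, $|\mathcal F_1(x,r)-\mathcal F_1(x,s)|\le M_1|r-s|$, and $\mathcal F_1(x,0)=0$. (2) $\mathcal F_2\colon(l,b)\times\mathbb R\to\mathbb R$ and there exist $m_2>0$, $M_2>0$ such that, for all $r,s\in\mathbb R$ and a.e. $x\in(l,b)$: $(\mathcal F_2(x,r)-\mathcal F_2(x,s))(r-s)\ge m_2|r-s|^2$, $|\mathcal F_2(x,r)-\mathcal F_2(x,s)|\le M_2|r-s|$, and $\mathcal F_2(x,0)=0$. (3) $p\colon\mathbb R\to\mathbb R$; there exists $L_p>0$ such that $|p(r_1)-p(r_2)|\le L_p|r_1-r_2|$ for all $r_1,r_2\in\mathbb R$; $p(r)>0$ if $r<2l$ and $p(r)<0$ if $r>2l$. (4) $m_1+m_2>2L_pL$. (5) $f_1\in L^2(a,-l)$ and $f_2\in L^2(l,b)$. (6) $q\colon\mathbb R\to\mathbb R$; there exists $L_q>0$ such that $|q(r_1)-q(r_2)|\le L_q|r_1-r_2|$ for all $r_1,r_2\in\mathbb R$; $(q(r_1)-q(r_2))(r_1-r_2)\le 0$ for all $r_1,r_2\in\mathbb R$; $q(r)\ge 0$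 if $r\le 2l$ and $q(r)\le 0$ if $r\ge 2l$. (7) $\{\lambda_n\}\subset\mathbb R$ is a sequence with $\lambda_n>0$ for all $n\in\mathbb N$ and $\lambda_n\to 0$ as $n\to\infty$. With $V$, $K$, $K'$, $K''$, $K'''$, $A$, $G$, $j$, $f$ as defined in the context, for each $n\in\mathbb N$ let $u_n$ be the unique solution of $$u_n\in K,\quad (Au_n,v-u_n)_V+\frac1{\lambda_n}(Gu_n,v-u_n)_V+j(u_n,v)-j(u_n,u_n)\ge (f,v-u_n)_V\quad\forall\, v\in K,$$ and let $u'$, $u''$, $u'''$ be the unique solutions of $$u'\in K',\quad (Au',v-u')_V+j(u',v)-j(u',u')\ge (f,v-u')_V\quad\forall\, v\in K',$$ $$u''\in K'',\quad (Au'',v-u'')_V+j(u'',v)-j(u'',u'')\ge (f,v-u'')_V\quad\forall\, v\in K'',$$ $$u'''\in K''',\quad (Au''',v-u''')_V+j(u''',v)-j(u''',u''')\ge (f,v-u''')_V\quad\forall\, v\in K''',$$ respectively. Then the following statements hold. a) If $q$ satisfies: $q(r)=0$ if and only if $r\ge 2l$, then $u_n\to u'$ in $V$ as $n\to\infty$. b) If $q$ satisfies: $q(r)=0$ if and only if $r\le 2l$, then $u_n\to u''$ in $V$ as $n\to\infty$. c) If $q$ satisfies: $q(r)=0$ if and only if $r=2l$, then $u_n\to u'''$ in $V$ as $n\to\infty$.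
   Context: Let $V_1=\{v_1\in H^1(a,-l): v_1(a)=0\}$ and $V_2=\{v_2\in H^1(l,b): v_2(b)=0\}$, and let $V=V_1\times V_2$, a real Hilbert space with inner product $$(u,v)_V=\int_a^{-l}\frac{du_1}{dx}\frac{dv_1}{dx}\,dx+\int_l^b\frac{du_2}{dx}\frac{dv_2}{dx}\,dx,\qquad u=(u_1,u_2),\ v=(v_1,v_2)\in V,$$ and associated norm $\|\cdot\|_V$; convergence in $V$ means convergence in this norm. Define $\theta\colon V\to\mathbb R$ by $$\theta(v)=2l-v_1(-l)+v_2(l),\qquad v=(v_1,v_2)\in V,$$ and the sets $$K=\{v\in V:\theta(v)\ge 0\},\quad K'=\{v\in V:\theta(v)\ge 2l\},$$ $$K''=\{v\in V:0\le\theta(v)\le 2l\},\quad K'''=\{v\in V:\theta(v)=2l\}.$$ The operator $A\colon V\to V$ is defined via the Riesz representation theorem by $$(Au,v)_V=\int_a^{-l}\mathcal F_1\Big(x,\frac{du_1}{dx}(x)\Big)\frac{dv_1}{dx}(x)\,dx+\int_l^b\mathcal F_2\Big(x,\frac{du_2}{dx}(x)\Big)\frac{dv_2}{dx}(x)\,dx\qquad\forall\, u,v\in V.$$ The operator $G\colon V\to V$ is defined via the Riesz representation theorem by $$(Gu,v)_V=q(\theta(u))\,v_1(-l)-q(\theta(u))\,v_2(l)\qquad\forall\, u,v\in V.$$ The function $j\colon V\times V\to\mathbb R$ is $j(u,v)=-p(\theta(u))\,\theta(v)$. The element $f\in V$ is defined via the Riesz representation theorem by $$(f,v)_V=\int_a^{-l}f_1v_1\,dx+\int_l^bf_2v_2\,dx\qquad\forall\,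 v\in V.$$ Under the stated assumptions, the paper asserts (before the theorem) that each of the four inequality problems in the claim has a unique solution; $u_n$, $u'$, $u''$, $u'''$ denote these solutions. *)

theory Defs
  imports "HOL-Analysis.Analysis"
begin

definition Lsq :: "real \<Rightarrow> real \<Rightarrow> (real \<Rightarrow> real) set" where
  "Lsq \<alpha> \<beta> = {f. f \<in> borel_measurable (lebesgue_on {\<alpha><..<\<beta>}) \<and>
                integrable (lebesgue_on {\<alpha><..<\<beta>}) (\<lambda>x. (f x)\<^sup>2)}"

text \<open>Test functions are the \<open>C\<^sup>1\<close> functions with compact support in \<open>(\<alpha>, \<beta>)\<close>, as in
  Brezis' treatment of Sobolev spaces on intervals; this yields the same weak derivatives as
  smooth test functions.\<close>

definition test_functions :: "real \<Rightarrow> real \<Rightarrow> (real \<Rightarrow> real) set" where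
  "test_functions \<alpha> \<beta> =
     {\<phi>. (\<forall>x. \<phi> field_differentiable at x) \<and> continuous_on UNIV (deriv \<phi>) \<and>
         (\<exists>c d. \<alpha> < c \<and> d < \<beta> \<and> (\<forall>x. x \<notin> {c..d} \<longrightarrow> \<phi> x = 0))}"

definition has_weak_derivative ::
  "real \<Rightarrow> real \<Rightarrow> (real \<Rightarrow> real) \<Rightarrow> (real \<Rightarrow> real) \<Rightarrow> bool" where
  "has_weak_derivative \<alpha> \<beta> u g \<longleftrightarrow>
     (\<forall>\<phi>\<in>test_functions \<alpha> \<beta>.
        (LINT x|lebesgue_on {\<alpha><..<\<beta>}. u x * deriv \<phi> x) =
        - (LINT x|lebesgue_on {\<alpha><..<\<beta>}. g x * \<phi> x))"

definition H1 :: "real \<Rightarrow> real \<Rightarrow> (real \<Rightarrow> real) set" where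
  "H1 \<alpha> \<beta> = {u \<in> Lsq \<alpha> \<beta>. \<exists>g\<in>Lsq \<alpha> \<beta>. has_weak_derivative \<alpha> \<beta> u g}"

text \<open>The weak derivative is determined only up to a null set; it is used only under integrals
  that do not depend on the choice.\<close>

definition wderiv :: "real \<Rightarrow> real \<Rightarrow> (real \<Rightarrow> real) \<Rightarrow> real \<Rightarrow> real" where
  "wderiv \<alpha> \<beta> u = (SOME g. g \<in> Lsq \<alpha> \<beta> \<and> has_weak_derivative \<alpha> \<beta> u g)"

text \<open>Every class in \<open>H\<^sup>1(\<alpha>, \<beta>)\<close> modulo null sets has exactly one representative that is continuous
  on \<open>[\<alpha>, \<beta>]\<close>; boundary values are the values of that representative. The class is encoded by this
  representative, extended by \<open>0\<close> outside \<open>[\<alpha>, \<beta>]\<close>. Thus equality of elements is HOL equality, and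
  differences are pointwise.\<close>

definition H1_rep :: "real \<Rightarrow> real \<Rightarrow> (real \<Rightarrow> real) set" where
  "H1_rep \<alpha> \<beta> = {u \<in> H1 \<alpha> \<beta>. continuous_on {\<alpha>..\<beta>} u \<and> (\<forall>x. x \<notin> {\<alpha>..\<beta>} \<longrightarrow> u x = 0)}"

type_synonym fpair = "(real \<Rightarrow> real) \<times> (real \<Rightarrow> real)"

definition V1 :: "real \<Rightarrow> real \<Rightarrow> (real \<Rightarrow> real) set" where
  "V1 a l = {v \<in> H1_rep a (- l). v a = 0}"

definition V2 :: "real \<Rightarrow> real \<Rightarrow> (real \<Rightarrow> real) set" where
  "V2 l b = {v \<in> H1_rep l b. v b = 0}"

definition V :: "real \<Rightarrow> real \<Rightarrow> real \<Rightarrow> fpair set" where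
  "V a l b = V1 a l \<times> V2 l b"

definition V_inner :: "real \<Rightarrow> real \<Rightarrow> real \<Rightarrow> fpair \<Rightarrow> fpair \<Rightarrow> real" where
  "V_inner a l b u v =
     (LINT x|lebesgue_on {a<..<- l}. wderiv a (- l) (fst u) x * wderiv a (- l) (fst v) x) +
     (LINT x|lebesgue_on {l<..<b}. wderiv l b (snd u) x * wderiv l b (snd v) x)"

definition V_norm :: "real \<Rightarrow> real \<Rightarrow> real \<Rightarrow> fpair \<Rightarrow> real" where
  "V_norm a l b v = sqrt (V_inner a l b v v)"

definition V_tendsto :: "real \<Rightarrow> real \<Rightarrow> real \<Rightarrow> (nat \<Rightarrow> fpair) \<Rightarrow> fpair \<Rightarrow> bool" where
  "V_tendsto a l b u w \<longleftrightarrow> (\<lambda>n. V_norm a l b (u n - w)) \<longlonglongrightarrow> 0"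

definition \<theta> :: "real \<Rightarrow> fpair \<Rightarrow> real" where
  "\<theta> l v = 2 * l - fst v (- l) + snd v l"

definition K0 :: "real \<Rightarrow> real \<Rightarrow> real \<Rightarrow> fpair set" where
  "K0 a l b = {v \<in> V a l b. \<theta> l v \<ge> 0}"

definition K1 :: "real \<Rightarrow> real \<Rightarrow> real \<Rightarrow> fpair set" where
  "K1 a l b = {v \<in> V a l b. \<theta> l v \<ge> 2 * l}"

definition K2 :: "real \<Rightarrow> real \<Rightarrow> real \<Rightarrow> fpair set" where
  "K2 a l b = {v \<in> V a l b. 0 \<le> \<theta> l v \<and> \<theta> l v \<le> 2 * l}"

definition K3 :: "real \<Rightarrow> real \<Rightarrow> real \<Rightarrow> fpair set" where
  "K3 a l b = {v \<in> V a l b. \<theta> l v = 2 * l}"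

text \<open>The element of \<open>V\<close> representing a bounded linear functional.\<close>

definition riesz :: "real \<Rightarrow> real \<Rightarrow> real \<Rightarrow> (fpair \<Rightarrow> real) \<Rightarrow> fpair" where
  "riesz a l b \<Phi> = (THE w. w \<in> V a l b \<and> (\<forall>v\<in>V a l b. V_inner a l b w v = \<Phi> v))"

definition opA ::
  "real \<Rightarrow> real \<Rightarrow> real \<Rightarrow> (real \<Rightarrow> real \<Rightarrow> real) \<Rightarrow> (real \<Rightarrow> real \<Rightarrow> real) \<Rightarrow> fpair \<Rightarrow> fpair" where
  "opA a l b F1 F2 u = riesz a l b (\<lambda>v.
     (LINT x|lebesgue_on {a<..<- l}. F1 x (wderiv a (- l) (fst u) x) * wderiv a (- l) (fst v) x) +
     (LINT x|lebesgue_on {l<..<b}. F2 x (wderiv l b (snd u) x) * wderiv l b (snd v) x))"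

definition opG :: "real \<Rightarrow> real \<Rightarrow> real \<Rightarrow> (real \<Rightarrow> real) \<Rightarrow> fpair \<Rightarrow> fpair" where
  "opG a l b q u = riesz a l b (\<lambda>v. q (\<theta> l u) * fst v (- l) - q (\<theta> l u) * snd v l)"

definition elt_f ::
  "real \<Rightarrow> real \<Rightarrow> real \<Rightarrow> (real \<Rightarrow> real) \<Rightarrow> (real \<Rightarrow> real) \<Rightarrow> fpair" where
  "elt_f a l b f1 f2 = riesz a l b (\<lambda>v.
     (LINT x|lebesgue_on {a<..<- l}. f1 x * fst v x) + (LINT x|lebesgue_on {l<..<b}. f2 x * snd v x))"

definition jfun :: "real \<Rightarrow> (real \<Rightarrow> real) \<Rightarrow> fpair \<Rightarrow> fpair \<Rightarrow> real" where
  "jfun l p u v = - p (\<theta> l u) * \<theta> l v"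

text \<open>\<open>S\<close> is the constraint set of the inequality.\<close>

definition solves ::
  "real \<Rightarrow> real \<Rightarrow> real \<Rightarrow> (real \<Rightarrow> real \<Rightarrow> real) \<Rightarrow> (real \<Rightarrow> real \<Rightarrow> real) \<Rightarrow> (real \<Rightarrow> real) \<Rightarrow>
   (real \<Rightarrow> real) \<Rightarrow> (real \<Rightarrow> real) \<Rightarrow> fpair set \<Rightarrow> fpair \<Rightarrow> bool" where
  "solves a l b F1 F2 p f1 f2 S u \<longleftrightarrow>
     u \<in> S \<and>
     (\<forall>v\<in>S. V_inner a l b (opA a l b F1 F2 u) (v - u) + jfun l p u v - jfun l p u u
            \<ge> V_inner a l b (elt_f a l b f1 f2) (v - u))"

definition solves_penalized ::
  "real \<Rightarrow> real \<Rightarrow> real \<Rightarrow> (real \<Rightarrow> real \<Rightarrow> real) \<Rightarrow> (real \<Rightarrow> real \<Rightarrow> real) \<Rightarrow> (real \<Rightarrow> real) \<Rightarrow>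
   (real \<Rightarrow> real) \<Rightarrow> (real \<Rightarrow> real) \<Rightarrow> (real \<Rightarrow> real) \<Rightarrow> real \<Rightarrow> fpair set \<Rightarrow> fpair \<Rightarrow> bool" where
  "solves_penalized a l b F1 F2 p f1 f2 q lam S u \<longleftrightarrow>
     u \<in> S \<and>
     (\<forall>v\<in>S. V_inner a l b (opA a l b F1 F2 u) (v - u)
            + 1 / lam * V_inner a l b (opG a l b q u) (v - u) + jfun l p u v - jfun l p u u
            \<ge> V_inner a l b (elt_f a l b f1 f2) (v - u))"

definition is_unique_solution :: "('a \<Rightarrow> bool) \<Rightarrow> 'a \<Rightarrow> bool" where
  "is_unique_solution P u \<longleftrightarrow> P u \<and> (\<forall>w. P w \<longrightarrow> w = u)"

end

theory Submission
  imports Defs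
begin

text \<open>
  Why the theorem holds. Elements of \<open>V\<close> are determined by their two derivatives, which may be
  arbitrary square-integrable functions, and \<open>\<theta>\<close> depends only on the sum of the integrals of the
  derivatives. Testing any of the inequalities with elements that have the same gap as the
  solution \<open>u\<close> shows that the residual of \<open>u\<close>, seen as a function paired with derivatives, is one
  and the same constant on both rods (\<open>flux_of_inequality\<close>). Up to sign this constant is the contact
  force \<open>s\<close>, and \<open>u\<close> is recovered from it by inverting the constitutive laws at almost every point.

  Strong monotonicity and Lipschitz continuity of the laws make the gap \<open>T(s)\<close> a strictly increasing
  bi-Lipschitz function of \<open>s\<close> (\<open>\<theta>_flux_bounds\<close>), and \<open>u\<close> depends on \<open>s\<close> in a Lipschitz way in the norm
  of \<open>V\<close> (\<open>V_norm_flux_bound\<close>). Each problem thus becomes a condition on one real number: the gap \<open>T(s)\<close>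
  is admissible and \<open>(s - c) (r - T(s)) \<ge> 0\<close> for all admissible gaps \<open>r\<close>, where \<open>c\<close> is \<open>p(T(s))\<close>,
  with \<open>q(T(s)) / \<lambda>\<^sub>n\<close> added for the penalized problems (\<open>solves_iff_scalar\<close>,
  \<open>solves_penalized_iff_scalar\<close>).

  For the scalar problems (\<open>scalar_penalization_limit\<close>), the test gap \<open>2l\<close> bounds the contact forces,
  since \<open>p\<close> and \<open>q\<close> are nonnegative below it and nonpositive above it. At the gap of a cluster point \<open>q\<close> vanishes, because \<open>\<lambda>\<^sub>n\<close> tends to zero, and
  the monotonicity of \<open>q\<close> lets the penalty term be dropped for test gaps at which \<open>q\<close> vanishes. Hence a
  cluster point solves the problem on the set where \<open>\<theta> \<ge> 0\<close> and \<open>q(\<theta>) = 0\<close>. The three cases of the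
  theorem are those in which this set is \<open>K'\<close>, \<open>K''\<close> and \<open>K'''\<close>; uniqueness of the respective
  solution yields convergence of the whole sequence.
\<close>

section \<open>Square-integrable functions on a bounded interval\<close>

locale interval =
  fixes \<alpha> \<beta> :: real
  assumes interval: "\<alpha> < \<beta>"
begin

abbreviation M :: "real measure" where
  "M \<equiv> lebesgue_on {\<alpha><..<\<beta>}"

text \<open>The primitive of \<open>g\<close> vanishing at the left endpoint. The indicator keeps the domain of
  integration independent of \<open>x\<close>, so that all statements live on one finite measure space.\<close>

definition prim :: "(real \<Rightarrow> real) \<Rightarrow> real \<Rightarrow> real" where
  "prim g x = (LINT y|M. indicator {..<x} y * g y)"

lemma finite_measure_M: "finite_measure M"
  by (intro finite_measure_lebesgue_on lmeasurable_open) auto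

sublocale M: finite_measure M
  by (rule finite_measure_M)

lemma measurable_ident_M [measurable]: "(\<lambda>x. x) \<in> borel_measurable M"
  using id_borel_measurable_lebesgue_on by (simp add: id_def)

lemma indicator_measurable_M [measurable]: "A \<in> sets borel \<Longrightarrow> indicat_real A \<in> borel_measurable M"
  by (rule measurable_compose[OF measurable_ident_M borel_measurable_indicator])

lemma measure_M: "measure M (space M) = \<beta> - \<alpha>"
  using interval by (simp add: measure_restrict_space)

lemma AE_M_neq: "AE x in M. x \<noteq> c"
proof -
  have "AE x in lebesgue. x \<noteq> c"
    using AE_lborel_singleton[of c] by (rule AE_completion)
  then have "AE x in lebesgue. \<alpha> < x \<and> x < \<beta> \<longrightarrow> x \<noteq> c" by eventually_elim simp
  then show ?thesis by (simp add: AE_restrict_space_iff)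
qed

lemma continuous_integrable_M:
  fixes f :: "real \<Rightarrow> real"
  assumes "continuous_on {\<alpha>..\<beta>} f"
  shows "integrable M f"
proof -
  have "integrable (lebesgue_on {\<alpha>..\<beta>}) f"
    by (rule continuous_imp_integrable_real[OF assms])
  moreover have "{\<alpha>..\<beta>} \<inter> {\<alpha><..<\<beta>} = {\<alpha><..<\<beta>}" by auto
  ultimately show ?thesis
    using integrable_mult_indicator[of "{\<alpha><..<\<beta>}" "lebesgue_on {\<alpha>..\<beta>}" f]
      integrable_restrict_space[of "{\<alpha><..<\<beta>}" "lebesgue_on {\<alpha>..\<beta>}" f]
    by (simp add: sets_restrict_space_iff restrict_restrict_space greaterThanLessThan_subseteq_atLeastAtMost_iff)
qed

lemma integrable_indicator_mult:
  assumes "A \<in> sets borel" "integrable M f"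
  shows "integrable M (\<lambda>x. indicator A x * f x :: real)"
proof (rule Bochner_Integration.integrable_bound[OF assms(2)])
  show "(\<lambda>x. indicator A x * f x) \<in> borel_measurable M"
    using assms by simp
  show "AE x in M. norm (indicator A x * f x) \<le> norm (f x)"
    by (simp add: indicator_def)
qed

lemma Lsq_measurable: "f \<in> Lsq \<alpha> \<beta> \<Longrightarrow> f \<in> borel_measurable M"
  by (simp add: Lsq_def)

lemma Lsq_square_integrable: "f \<in> Lsq \<alpha> \<beta> \<Longrightarrow> integrable M (\<lambda>x. (f x)\<^sup>2)"
  by (simp add: Lsq_def)

lemma Lsq_integrable: "f \<in> Lsq \<alpha> \<beta> \<Longrightarrow> integrable M f"
  by (rule M.square_integrable_imp_integrable[OF Lsq_measurable Lsq_square_integrable])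

lemma Lsq_mult_integrable:
  assumes "f \<in> Lsq \<alpha> \<beta>" "g \<in> Lsq \<alpha> \<beta>"
  shows "integrable M (\<lambda>x. f x * g x)"
proof (rule Bochner_Integration.integrable_bound)
  show "integrable M (\<lambda>x. (f x)\<^sup>2 + (g x)\<^sup>2)"
    using assms by (simp add: Lsq_def)
  show "(\<lambda>x. f x * g x) \<in> borel_measurable M"
    using assms[THEN Lsq_measurable] by simp
  show "AE x in M. norm (f x * g x) \<le> norm ((f x)\<^sup>2 + (g x)\<^sup>2)"
  proof (rule AE_I2)
    fix x
    have "2 * (\<bar>f x\<bar> * \<bar>g x\<bar>) \<le> (f x)\<^sup>2 + (g x)\<^sup>2"
      using sum_squares_bound[of "\<bar>f x\<bar>" "\<bar>g x\<bar>"] unfolding power2_abs mult.assoc .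
    moreover have "0 \<le> \<bar>f x\<bar> * \<bar>g x\<bar>" by simp
    ultimately show "norm (f x * g x) \<le> norm ((f x)\<^sup>2 + (g x)\<^sup>2)"
      unfolding real_norm_def abs_mult by linarith
  qed
qed

lemma Lsq_dominated:
  assumes "f \<in> Lsq \<alpha> \<beta>" "g \<in> borel_measurable M" "AE x in M. \<bar>g x\<bar> \<le> K * \<bar>f x\<bar>"
  shows "g \<in> Lsq \<alpha> \<beta>"
proof -
  have "integrable M (\<lambda>x. (g x)\<^sup>2)"
  proof (rule Bochner_Integration.integrable_bound)
    show "integrable M (\<lambda>x. K\<^sup>2 * (f x)\<^sup>2)"
      using assms(1) by (simp add: Lsq_def)
    show "(\<lambda>x. (g x)\<^sup>2) \<in> borel_measurable M"
      using assms(2) by simp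
    show "AE x in M. norm ((g x)\<^sup>2) \<le> norm (K\<^sup>2 * (f x)\<^sup>2)"
      using assms(3)
    proof eventually_elim
      case (elim x)
      then show ?case
        using power_mono[OF elim abs_ge_zero, of 2] unfolding power_mult_distrib power2_abs by auto
    qed
  qed
  then show ?thesis using assms(2) by (simp add: Lsq_def)
qed

lemma Lsq_add: 
  assumes "f \<in> Lsq \<alpha> \<beta>" "g \<in> Lsq \<alpha> \<beta>" shows "(\<lambda>x. f x + g x) \<in> Lsq \<alpha> \<beta>"
proof -
  have "integrable M (\<lambda>x. (f x)\<^sup>2 + 2 * (f x * g x) + (g x)\<^sup>2)"
    using assms Lsq_mult_integrable[OF assms]
    by (intro Bochner_Integration.integrable_add integrable_mult_right) (auto simp: Lsq_def)
  moreover have "(\<lambda>x. (f x)\<^sup>2 + 2 * (f x * g x) + (g x)\<^sup>2) = (\<lambda>x. (f x + g x)\<^sup>2)"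
    by (simp add: power2_sum mult.assoc add_ac)
  ultimately show ?thesis
    using assms[THEN Lsq_measurable] by (simp add: Lsq_def)
qed

lemma Lsq_cmult: "f \<in> Lsq \<alpha> \<beta> \<Longrightarrow> (\<lambda>x. c * f x) \<in> Lsq \<alpha> \<beta>"
  by (auto simp: Lsq_def power_mult_distrib)

lemma Lsq_diff:
  assumes "f \<in> Lsq \<alpha> \<beta>" "g \<in> Lsq \<alpha> \<beta>" shows "(\<lambda>x. f x - g x) \<in> Lsq \<alpha> \<beta>"
  using Lsq_add[OF assms(1) Lsq_cmult[OF assms(2), of "-1"]] by simp

lemma Lsq_const: "(\<lambda>x. c) \<in> Lsq \<alpha> \<beta>"
  by (simp add: Lsq_def)

lemma Lsq_continuous:
  assumes "continuous_on {\<alpha>..\<beta>} f"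
  shows "f \<in> Lsq \<alpha> \<beta>"
  using continuous_integrable_M[OF assms] continuous_integrable_M[OF continuous_on_power[OF assms, of 2]]
  by (simp add: Lsq_def borel_measurable_integrable)

lemma prim_left: "prim g \<alpha> = 0"
proof -
  have "prim g \<alpha> = (LINT y|M. 0)"
    unfolding prim_def by (intro Bochner_Integration.integral_cong) auto
  then show ?thesis by simp
qed

lemma prim_right: "prim g \<beta> = (LINT y|M. g y)"
  unfolding prim_def by (intro Bochner_Integration.integral_cong) auto

lemma prim_diff:
  assumes "integrable M f" "integrable M g"
  shows "prim (\<lambda>x. f x - g x) x = prim f x - prim g x"
  unfolding prim_def using assms
  by (simp add: right_diff_distrib integrable_indicator_mult)

lemma prim_tail:
  assumes "integrable M f"
  shows "(LINT y|M. indicator {x<..} y * f y) = (LINT y|M. f y) - prim f x"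
proof -
  note [measurable] = borel_measurable_integrable[OF assms]
  have "(LINT y|M. indicator {x<..} y * f y) + prim f x
      = (LINT y|M. indicator {x<..} y * f y + indicator {..<x} y * f y)"
    unfolding prim_def using assms by (simp add: integrable_indicator_mult)
  also have "\<dots> = (LINT y|M. f y)"
  proof (rule integral_cong_AE)
    show "AE y in M. indicator {x<..} y * f y + indicator {..<x} y * f y = f y"
      using AE_M_neq[of x] by eventually_elim (auto simp: indicator_def)
  qed simp_all
  finally show ?thesis by simp
qed

lemma continuous_prim:
  assumes "integrable M g"
  shows "continuous_on UNIV (prim g)"
proof -
  note [measurable] = borel_measurable_integrable[OF assms]
  have "isCont (prim g) x" for x
    unfolding continuous_at_sequentially comp_def
  proof safe
    fix X :: "nat \<Rightarrow> real" assume X: "X \<longlonglongrightarrow> x"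
    show "(\<lambda>n. prim g (X n)) \<longlonglongrightarrow> prim g x"
      unfolding prim_def
    proof (rule integral_dominated_convergence[where w = "\<lambda>y. \<bar>g y\<bar>"])
      show "AE y in M. (\<lambda>n. indicator {..<X n} y * g y) \<longlonglongrightarrow> indicator {..<x} y * g y"
        using AE_M_neq[of x]
      proof eventually_elim
        case (elim y)
        have "eventually (\<lambda>n. indicat_real {..<X n} y = indicator {..<x} y) sequentially"
        proof (cases "y < x")
          case True
          then show ?thesis
            using order_tendstoD(1)[OF X True] by (auto elim!: eventually_mono simp: indicator_def)
        next
          case False
          then have "x < y" using elim by simp
          from order_tendstoD(2)[OF X this] show ?thesis
            using False by (auto elim!: eventually_mono simp: indicator_def)
        qed
        then have "eventually (\<lambda>n. indicator {..<X n} y * g y = indicator {..<x} y * g y) sequentially"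
          by eventually_elim simp
        then show ?case by (rule tendsto_eventually)
      qed
      show "AE y in M. norm (indicator {..<X n} y * g y) \<le> \<bar>g y\<bar>" for n
        by (simp add: indicator_def)
    qed (use assms in simp_all)
  qed
  then show ?thesis by (simp add: continuous_on_eq_continuous_at)
qed

lemma prim_Lsq: "integrable M g \<Longrightarrow> prim g \<in> Lsq \<alpha> \<beta>"
  by (intro Lsq_continuous continuous_on_subset[OF continuous_prim]) auto

text \<open>Fubini on the square: the two iterated integrals are those of \<open>f x * g y\<close> over the triangles
  below and above the diagonal, and the diagonal is a null set. This identity shows that a primitive
  is weakly differentiable, and it turns the load functional into one acting on derivatives.\<close>

lemma prim_by_parts:
  assumes f: "integrable M f" and g: "integrable M g"
  shows "(LINT x|M. f x * prim g x) + (LINT x|M. g x * prim f x) = (LINT x|M. f x) * (LINT x|M. g x)"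
proof -
  interpret P: pair_sigma_finite M M ..
  note [measurable] = borel_measurable_integrable[OF f] borel_measurable_integrable[OF g]
  have prod: "integrable (M \<Otimes>\<^sub>M M) (\<lambda>z. f (fst z) * g (snd z))"
  proof (rule P.Fubini_integrable)
    show "integrable M (\<lambda>x. \<integral> y. norm (f (fst (x, y)) * g (snd (x, y))) \<partial>M)"
      using f by (simp add: norm_mult abs_mult integrable_norm)
    show "(\<lambda>z. f (fst z) * g (snd z)) \<in> borel_measurable (M \<Otimes>\<^sub>M M)" by measurable
    show "AE x in M. integrable M (\<lambda>y. f (fst (x, y)) * g (snd (x, y)))" using g by simp
  qed
  have int: "integrable (M \<Otimes>\<^sub>M M) (case_prod (\<lambda>x y. indicator {..<x} y * (f x * g y)))"
  proof (rule Bochner_Integration.integrable_bound[OF prod])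
    have "case_prod (\<lambda>x y. indicator {..<x} y * (f x * g y)) =
          (\<lambda>z. if snd z < fst z then f (fst z) * g (snd z) else 0)"
      by (auto simp: fun_eq_iff)
    then show "case_prod (\<lambda>x y. indicator {..<x} y * (f x * g y)) \<in> borel_measurable (M \<Otimes>\<^sub>M M)"
      by simp
  qed (auto simp: indicator_def)
  have "(LINT x|M. f x * prim g x) = (LINT x|M. LINT y|M. indicator {..<x} y * (f x * g y))"
  proof -
    have "f x * prim g x = (LINT y|M. indicator {..<x} y * (f x * g y))" for x
      unfolding prim_def by (subst integral_mult_right_zero[symmetric]) (simp only: mult.left_commute)
    then show ?thesis by simp
  qed
  also have "\<dots> = (LINT y|M. LINT x|M. indicator {..<x} y * (f x * g y))"
    using P.Fubini_integral[OF int] by simp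
  also have "\<dots> = (LINT y|M. g y * (LINT x|M. indicator {y<..} x * f x))"
  proof -
    have "(\<lambda>x. indicator {..<x} y * (f x * g y)) = (\<lambda>x. g y * (indicator {y<..} x * f x))" for y
      by (auto simp: fun_eq_iff indicator_def)
    then show ?thesis by simp
  qed
  also have "\<dots> = (LINT y|M. g y * (LINT x|M. f x) - g y * prim f y)"
    by (simp add: prim_tail[OF f] right_diff_distrib)
  also have "\<dots> = (LINT y|M. g y * (LINT x|M. f x)) - (LINT y|M. g y * prim f y)"
  proof (rule Bochner_Integration.integral_diff)
    obtain B where B: "\<And>x. x \<in> {\<alpha>..\<beta>} \<Longrightarrow> \<bar>prim f x\<bar> \<le> B"
    proof -
      have "compact (prim f ` {\<alpha>..\<beta>})"
        by (intro compact_continuous_image continuous_on_subset[OF continuous_prim[OF f]]) auto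
      then have "bounded (prim f ` {\<alpha>..\<beta>})" by (rule compact_imp_bounded)
      then obtain B where "\<forall>y\<in>prim f ` {\<alpha>..\<beta>}. norm y \<le> B" by (auto simp: bounded_iff)
      then show ?thesis by (intro that[of B]) auto
    qed
    have [measurable]: "prim f \<in> borel_measurable M"
      using prim_Lsq[OF f] by (rule Lsq_measurable)
    show "integrable M (\<lambda>y. g y * prim f y)"
    proof (rule Bochner_Integration.integrable_bound)
      show "integrable M (\<lambda>y. B * g y)" using g by simp
      show "AE y in M. norm (g y * prim f y) \<le> norm (B * g y)"
      proof (rule AE_I2)
        fix y assume "y \<in> space M"
        then have "\<bar>prim f y\<bar> \<le> \<bar>B\<bar>" using B[of y] by auto
        then show "norm (g y * prim f y) \<le> norm (B * g y)"
          using mult_left_mono[of "\<bar>prim f y\<bar>" "\<bar>B\<bar>" "\<bar>g y\<bar>"] by (simp add: abs_mult mult.commute)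
      qed
    qed simp
  qed (use g in simp)
  finally show ?thesis by simp
qed

lemma integral_M_eq_HK:
  fixes f :: "real \<Rightarrow> real"
  assumes "integrable M f"
  shows "(LINT x|M. f x) = integral {\<alpha>..\<beta>} f"
  using lebesgue_integral_eq_integral[OF assms] by (simp add: integral_open_interval_real)

text \<open>The signed measure with density \<open>g\<close> vanishes on all half-lines, hence on the Borel sets, which they
  generate as an intersection-stable family, and hence on the Lebesgue sets, which differ from Borel
  sets by null sets. This yields the uniqueness of weak derivatives.\<close>

lemma prim_eq_zero_imp_AE_zero:
  assumes g: "integrable M g" and zero: "\<And>x. x \<in> {\<alpha>..\<beta>} \<Longrightarrow> prim g x = 0"
  shows "AE x in M. g x = 0"
proof -
  note [measurable] = borel_measurable_integrable[OF g]
  have all: "prim g x = 0" for x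
  proof -
    consider "x \<le> \<alpha>" | "x \<ge> \<beta>" | "x \<in> {\<alpha>..\<beta>}" by fastforce
    then show ?thesis
    proof cases
      case 1
      then have "prim g x = (LINT y|M. 0)"
        unfolding prim_def by (intro Bochner_Integration.integral_cong) auto
      then show ?thesis by simp
    next
      case 2
      then have "prim g x = prim g \<beta>"
        unfolding prim_def by (intro Bochner_Integration.integral_cong) (auto simp: indicator_def)
      then show ?thesis using zero[of \<beta>] interval by simp
    qed (rule zero)
  qed
  have total: "(LINT y|M. g y) = 0"
    using all[of \<beta>] by (simp add: prim_right)
  have borel0: "(LINT y|M. indicator B y * g y) = 0" if "B \<in> sets borel" for B
  proof -
    have gen: "sets (borel :: real measure) = sigma_sets UNIV (range lessThan)"
      by (simp add: borel_Iio)
    have B: "B \<in> sigma_sets UNIV (range lessThan)" using gen that by simp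
    have closed: "range (lessThan :: real \<Rightarrow> real set) \<subseteq> Pow UNIV" by simp
    have "Int_stable (range (lessThan :: real \<Rightarrow> real set))"
      
    proof (rule Int_stableI)
      have "{..<a} \<inter> {..<b} = {..<min a b}" for a b :: real by auto
      then show "A \<inter> B \<in> range lessThan"
        if "A \<in> range lessThan" "B \<in> range lessThan" for A B :: "real set"
        using that by auto
    qed
    from this closed B show ?thesis
    proof (induction rule: sigma_sets_induct_disjoint)
      case (basic A)
      then show ?case using all by (auto simp: prim_def)
    next
      case empty
      then show ?case by simp
    next
      case (compl A)
      then have A: "A \<in> sets borel" using gen by simp
      have "(LINT y|M. indicator (UNIV - A) y * g y) = (LINT y|M. g y - indicator A y * g y)"
        by (intro Bochner_Integration.integral_cong) (auto simp: indicator_def)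
      also have "\<dots> = 0"
        using compl(2) g A total by (simp add: integrable_indicator_mult)
      finally show ?case .
    next
      case (union A)
      then have A: "\<And>i. A i \<in> sets borel" using gen by auto
      have "((\<lambda>n. LINT y|M. indicator (\<Union>i<n. A i) y * g y)) \<longlonglongrightarrow> (LINT y|M. indicator (\<Union>i. A i) y * g y)"
      proof (rule integral_dominated_convergence[where w = "\<lambda>y. \<bar>g y\<bar>"])
        show "AE y in M. (\<lambda>n. indicator (\<Union>i<n. A i) y * g y) \<longlonglongrightarrow> indicator (\<Union>i. A i) y * g y"
          by (rule AE_I2, rule tendsto_mult[OF LIMSEQ_indicator_UN tendsto_const])
        show "AE y in M. norm (indicator (\<Union>i<n. A i) y * g y) \<le> \<bar>g y\<bar>" for n
          by (simp add: indicator_def)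
      qed (use g A in simp_all)
      moreover have "(LINT y|M. indicator (\<Union>i<n. A i) y * g y) = 0" for n
      proof -
        have "(\<lambda>y. indicator (\<Union>i<n. A i) y * g y) = (\<lambda>y. \<Sum>i<n. indicator (A i) y * g y)"
        proof
          fix y
          have "indicat_real (\<Union>i<n. A i) y = (\<Sum>i<n. indicator (A i) y)"
            by (rule indicator_UN_disjoint) (use union(1) in \<open>auto simp: disjoint_family_on_def\<close>)
          then show "indicator (\<Union>i<n. A i) y * g y = (\<Sum>i<n. indicator (A i) y * g y)"
            by (simp only: sum_distrib_right)
        qed
        then have "(LINT y|M. indicator (\<Union>i<n. A i) y * g y) = (\<Sum>i<n. LINT y|M. indicator (A i) y * g y)"
          by (simp only: Bochner_Integration.integral_sum[OF integrable_indicator_mult[OF A g]])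
        then show ?thesis using union(3) by simp
      qed
      ultimately show ?case by (simp add: LIMSEQ_const_iff)
    qed
  qed
  show ?thesis
  proof (rule M.density_zero[OF g])
    fix A assume "A \<in> sets M"
    then have A: "A \<in> sets lebesgue" "A \<subseteq> {\<alpha><..<\<beta>}"
      by (auto simp: sets_restrict_space_iff)
    then have "A \<in> sets (completion lborel)" by simp
    then obtain S N N' where S: "A = S \<union> N" "S \<in> sets lborel" "N \<subseteq> N'" "N' \<in> null_sets lborel"
      by (rule sets_completionE) blast
    have "AE x in lebesgue. x \<notin> N'"
      using S(4) by (intro AE_completion AE_not_in)
    then have "AE x in lebesgue. x \<in> {\<alpha><..<\<beta>} \<longrightarrow> x \<notin> N'" by eventually_elim simp
    then have N': "AE x in M. x \<notin> N'"
      by (simp add: AE_restrict_space_iff)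
    have "set_lebesgue_integral M A g = (LINT y|M. indicator S y * g y)"
      unfolding set_lebesgue_integral_def
    proof (rule integral_cong_AE)
      show "AE x in M. indicat_real A x *\<^sub>R g x = indicat_real S x * g x"
        using N' by eventually_elim (use S(1,3) in \<open>auto simp: indicator_def\<close>)
    qed (use \<open>A \<in> sets M\<close> S(2) in simp_all)
    then show "set_lebesgue_integral M A g = 0" using borel0 S(2) by simp
  qed
qed


section \<open>Weak derivatives and primitives\<close>

lemma test_functionD:
  assumes "\<phi> \<in> test_functions \<alpha> \<beta>"
  shows "(\<phi> has_real_derivative deriv \<phi> x) (at x)"
    and "continuous_on UNIV (deriv \<phi>)" and "\<phi> \<alpha> = 0" and "\<phi> \<beta> = 0"
proof -
  have diff: "\<And>x. \<phi> field_differentiable at x"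
    using assms by (simp add: test_functions_def)
  then show "(\<phi> has_real_derivative deriv \<phi> x) (at x)"
    by (simp add: DERIV_deriv_iff_field_differentiable)
  show "continuous_on UNIV (deriv \<phi>)"
    using assms by (simp add: test_functions_def)
  show "\<phi> \<alpha> = 0" "\<phi> \<beta> = 0"
    using assms by (auto simp: test_functions_def)
qed

lemma prim_of_derivative:
  assumes deriv: "\<And>x. (\<phi> has_real_derivative \<phi>' x) (at x)" and cont: "continuous_on UNIV \<phi>'"
    and x: "x \<in> {\<alpha>..\<beta>}"
  shows "prim \<phi>' x = \<phi> x - \<phi> \<alpha>"
proof -
  have int: "integrable M \<phi>'"
    by (rule continuous_integrable_M[OF continuous_on_subset[OF cont]]) simp
  have "prim \<phi>' x = integral {\<alpha>..\<beta>} (\<lambda>y. indicator {..<x} y * \<phi>' y)"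
    unfolding prim_def
    by (rule integral_M_eq_HK) (simp add: integrable_indicator_mult int)
  also have "(\<lambda>y. indicator {..<x} y * \<phi>' y) = (\<lambda>y. if y \<in> {..<x} then \<phi>' y else 0)"
    by (auto simp: indicator_def)
  also have "integral {\<alpha>..\<beta>} (\<lambda>y. if y \<in> {..<x} then \<phi>' y else 0) = integral ({\<alpha>..\<beta>} \<inter> {..<x}) \<phi>'"
    by (subst Int_commute) (rule Henstock_Kurzweil_Integration.integral_restrict_Int)
  also have "\<dots> = integral {\<alpha>..x} \<phi>'"
  proof (rule integral_spike_set)
    have "{y \<in> {\<alpha>..\<beta>} \<inter> {..<x} - {\<alpha>..x}. \<phi>' y \<noteq> 0} \<subseteq> {x}" 
      "{y \<in> {\<alpha>..x} - {\<alpha>..\<beta>} \<inter> {..<x}. \<phi>' y \<noteq> 0} \<subseteq> {x}"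
      using x by auto
    then show "negligible {y \<in> {\<alpha>..\<beta>} \<inter> {..<x} - {\<alpha>..x}. \<phi>' y \<noteq> 0}"
      "negligible {y \<in> {\<alpha>..x} - {\<alpha>..\<beta>} \<inter> {..<x}. \<phi>' y \<noteq> 0}"
      by (meson negligible_sing negligible_subset)+
  qed
  also have "\<dots> = \<phi> x - \<phi> \<alpha>"
  proof (rule integral_unique, rule fundamental_theorem_of_calculus)
    show "\<alpha> \<le> x" using x by simp
    show "(\<phi> has_vector_derivative \<phi>' y) (at y within {\<alpha>..x})" for y
      using deriv[of y]
      by (simp add: has_real_derivative_iff_has_vector_derivative has_vector_derivative_at_within)
  qed
  finally show ?thesis .
qed

lemma prim_deriv_test_function:
  assumes "\<phi> \<in> test_functions \<alpha> \<beta>" "x \<in> {\<alpha>..\<beta>}"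
  shows "prim (deriv \<phi>) x = \<phi> x"
  using prim_of_derivative[of \<phi> "deriv \<phi>" x] test_functionD[OF assms(1)] assms(2) by simp

lemma deriv_test_function_Lsq:
  assumes "\<phi> \<in> test_functions \<alpha> \<beta>"
  shows "deriv \<phi> \<in> Lsq \<alpha> \<beta>"
  by (rule Lsq_continuous[OF continuous_on_subset[OF test_functionD(2)[OF assms]]]) simp

text \<open>Integration by parts moves the derivative from the test function to the primitive; the boundary
  terms vanish because a test function is zero at both endpoints.\<close>

lemma has_weak_derivative_prim:
  assumes g: "g \<in> Lsq \<alpha> \<beta>" and u: "\<And>x. x \<in> {\<alpha><..<\<beta>} \<Longrightarrow> u x = c + prim g x"
  shows "has_weak_derivative \<alpha> \<beta> u g"
  unfolding has_weak_derivative_def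
proof
  fix \<phi> assume \<phi>: "\<phi> \<in> test_functions \<alpha> \<beta>"
  note L = deriv_test_function_Lsq[OF \<phi>]
  have zero: "(LINT x|M. deriv \<phi> x) = 0"
    using prim_deriv_test_function[OF \<phi>, of \<beta>] interval test_functionD(4)[OF \<phi>]
    by (simp add: prim_right)
  have "(LINT x|M. u x * deriv \<phi> x) = (LINT x|M. c * deriv \<phi> x + deriv \<phi> x * prim g x)"
    by (intro Bochner_Integration.integral_cong) (simp_all add: u algebra_simps)
  also have "\<dots> = c * (LINT x|M. deriv \<phi> x) + (LINT x|M. deriv \<phi> x * prim g x)"
    using Lsq_mult_integrable[OF L prim_Lsq[OF Lsq_integrable[OF g]]] Lsq_integrable[OF L] by simp
  also have "\<dots> = - (LINT x|M. g x * prim (deriv \<phi>) x)"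
    using prim_by_parts[OF Lsq_integrable[OF L] Lsq_integrable[OF g]] zero by simp
  also have "(LINT x|M. g x * prim (deriv \<phi>) x) = (LINT x|M. g x * \<phi> x)"
    by (intro Bochner_Integration.integral_cong) (simp_all add: prim_deriv_test_function[OF \<phi>])
  finally show "(LINT x|M. u x * deriv \<phi> x) = - (LINT x|M. g x * \<phi> x)" .
qed

text \<open>The du Bois-Reymond argument. Let \<open>\<eta>\<close> be positive exactly on \<open>(c, d)\<close>, and let \<open>k\<close> be the mean of \<open>w\<close>
  with respect to the weight \<open>\<eta>\<close>. Then \<open>\<psi> = \<eta> (w - k)\<close> has integral zero, so it is the derivative of a
  test function, and testing \<open>w\<close> with it gives \<open>\<integral> \<eta> (w - k)\<^sup>2 = 0\<close>.\<close>

lemma weakly_constant_on_subinterval: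
  assumes cont: "continuous_on {\<alpha>..\<beta>} w"
    and weak: "\<And>\<phi>. \<phi> \<in> test_functions \<alpha> \<beta> \<Longrightarrow> (LINT x|M. w x * deriv \<phi> x) = 0"
    and cd: "\<alpha> < c" "c < d" "d < \<beta>"
  shows "\<exists>k. \<forall>x\<in>{c<..<d}. w x = k"
proof -
  define \<eta> :: "real \<Rightarrow> real" where "\<eta> x = max 0 ((x - c) * (d - x))" for x
  \<comment> \<open>clamping extends \<open>w\<close> continuously to the whole line without changing it on \<open>[c, d]\<close>\<close>
  define W where "W x = w (min d (max c x))" for x
  have cont\<eta>: "continuous_on UNIV \<eta>"
    unfolding \<eta>_def by (intro continuous_intros)
  have contW: "continuous_on UNIV W"
    unfolding W_def
    by (rule continuous_on_compose2[OF cont]) (use cd in \<open>auto intro!: continuous_intros\<close>)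
  have \<eta>_nonneg: "\<eta> x \<ge> 0" for x
    by (simp add: \<eta>_def)
  have \<eta>_pos: "\<eta> x > 0" if "x \<in> {c<..<d}" for x
    using that by (simp add: \<eta>_def)
  have \<eta>_out: "\<eta> x = 0" if "x \<notin> {c<..<d}" for x
  proof -
    have "(x - c) * (d - x) \<le> 0"
      using that cd by (auto simp: mult_le_0_iff not_less)
    then show ?thesis by (simp add: \<eta>_def)
  qed
  have int: "integrable M f" if "continuous_on UNIV f" for f :: "real \<Rightarrow> real"
    by (rule continuous_integrable_M[OF continuous_on_subset[OF that]]) simp
  have zero_imp: "f x = 0"
    if f: "continuous_on UNIV f" "\<And>x. f x \<ge> 0" "(LINT x|M. f x) = 0" and x: "x \<in> {c<..<d}"
    for f :: "real \<Rightarrow> real" and x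
  proof -
    have "integral {\<alpha>..\<beta>} f = 0"
      using integral_M_eq_HK[OF int[OF f(1)]] f(3) by simp
    moreover have "continuous_on {\<alpha>..\<beta>} f"
      by (rule continuous_on_subset[OF f(1)]) simp
    ultimately have "\<forall>x\<in>{\<alpha>..\<beta>}. f x = 0"
      using integral_eq_0_iff[of \<alpha> \<beta> f] interval f(2) by blast
    then show ?thesis using x cd by simp
  qed
  let ?m = "LINT x|M. \<eta> x"
  have m: "?m \<noteq> 0"
  proof
    assume "?m = 0"
    then have "\<eta> ((c + d) / 2) = 0"
      by (rule zero_imp[OF cont\<eta> \<eta>_nonneg]) (use cd in simp)
    then show False using \<eta>_pos[of "(c + d) / 2"] cd by simp
  qed
  define k where "k = (LINT x|M. \<eta> x * W x) / ?m"
  define \<psi> where "\<psi> x = \<eta> x * (W x - k)" for x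
  have cont\<psi>: "continuous_on UNIV \<psi>"
    unfolding \<psi>_def by (intro continuous_intros cont\<eta> contW)
  have "(LINT x|M. \<psi> x) = (LINT x|M. \<eta> x * W x - k * \<eta> x)"
    unfolding \<psi>_def by (simp add: algebra_simps)
  also have "\<dots> = (LINT x|M. \<eta> x * W x) - k * ?m"
    using int[OF cont\<eta>] int[OF continuous_on_mult[OF cont\<eta> contW]] by simp
  also have "\<dots> = 0" using m by (simp add: k_def)
  finally have int\<psi>: "(LINT x|M. \<psi> x) = 0" .
  obtain \<Phi> where \<Phi>: "\<And>x. (\<Phi> has_real_derivative \<psi> x) (at x)"
  proof -
    have "\<exists>F. \<forall>x::real. -\<infinity> < ereal x \<longrightarrow> ereal x < \<infinity> \<longrightarrow> (F has_vector_derivative \<psi> x) (at x)"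
      by (rule einterval_antiderivative)
         (use cont\<psi> in \<open>auto simp: continuous_on_eq_continuous_at\<close>)
    then show ?thesis
      using that by (auto simp: has_real_derivative_iff_has_vector_derivative)
  qed
  have const: "\<Phi> x = \<Phi> y" if "x \<le> y" "\<forall>z\<in>{x<..<y}. \<psi> z = 0" for x y
  proof (cases "x = y")
    case False
    show ?thesis
    proof (rule DERIV_isconst_end[of x y \<Phi>, symmetric])
      show "x < y" using False that by simp
      show "continuous_on {x..y} \<Phi>"
        by (intro continuous_at_imp_continuous_on ballI DERIV_isCont[OF \<Phi>])
      show "DERIV \<Phi> z :> 0" if z: "x < z" "z < y" for z
        using \<Phi>[of z] \<open>\<forall>z\<in>{x<..<y}. \<psi> z = 0\<close> z by simp
    qed
  qed simp
  define \<phi> where "\<phi> x = \<Phi> x - \<Phi> c" for x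
  have d\<phi>: "(\<phi> has_real_derivative \<psi> x) (at x)" for x
    unfolding \<phi>_def using \<Phi>[of x] by (auto intro!: derivative_eq_intros)
  have deriv\<phi>: "deriv \<phi> = \<psi>"
    using d\<phi> by (auto simp: fun_eq_iff intro: DERIV_imp_deriv)
  have left: "\<phi> x = 0" if "x \<le> c" for x
  proof -
    have "\<Phi> x = \<Phi> c"
      by (rule const[OF that]) (simp add: \<eta>_out \<psi>_def)
    then show ?thesis by (simp add: \<phi>_def)
  qed
  have "\<phi> \<beta> = 0"
    using prim_of_derivative[OF d\<phi> cont\<psi>, of \<beta>] int\<psi> left[of \<alpha>] cd interval by (simp add: prim_right)
  moreover have "\<Phi> d = \<Phi> \<beta>"
    by (rule const) (use \<eta>_out cd in \<open>simp_all add: \<psi>_def\<close>)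
  moreover have "\<Phi> d = \<Phi> x" if "x \<ge> d" for x
    by (rule const[OF that]) (simp add: \<eta>_out \<psi>_def)
  ultimately have right: "\<phi> x = 0" if "x \<ge> d" for x
    using that by (simp add: \<phi>_def)
  have "\<phi> \<in> test_functions \<alpha> \<beta>"
    unfolding test_functions_def mem_Collect_eq deriv\<phi>
  proof (intro conjI allI exI)
    show "\<phi> field_differentiable at x" for x
      using d\<phi> by (auto simp: field_differentiable_def)
    show "x \<notin> {c..d} \<longrightarrow> \<phi> x = 0" for x
      using left right by auto
  qed (use cd cont\<psi> in auto)
  from weak[OF this] have "(LINT x|M. w x * \<psi> x) = 0"
    by (simp add: deriv\<phi>)
  moreover have "w x * \<psi> x = \<eta> x * (W x - k)\<^sup>2 + k * \<psi> x" for x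
  proof (cases "x \<in> {c<..<d}")
    case True
    then have "W x = w x" by (simp add: W_def)
    then show ?thesis by (simp add: \<psi>_def power2_eq_square algebra_simps)
  next
    case False
    then show ?thesis by (simp add: \<psi>_def \<eta>_out)
  qed
  ultimately have "(LINT x|M. \<eta> x * (W x - k)\<^sup>2 + k * \<psi> x) = 0" by simp
  moreover have contsq: "continuous_on UNIV (\<lambda>x. \<eta> x * (W x - k)\<^sup>2)"
    by (intro continuous_intros cont\<eta> contW)
  ultimately have int0: "(LINT x|M. \<eta> x * (W x - k)\<^sup>2) = 0"
    using int[OF contsq] int[OF cont\<psi>] int\<psi> by simp
  have sq: "\<eta> x * (W x - k)\<^sup>2 = 0" if "x \<in> {c<..<d}" for x
    by (rule zero_imp[OF contsq _ int0 that]) (simp add: \<eta>_nonneg)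
  have "w x = k" if "x \<in> {c<..<d}" for x
    using sq[OF that] \<eta>_pos[OF that] that by (simp add: W_def)
  then show ?thesis by blast
qed

lemma weakly_constant:
  assumes cont: "continuous_on {\<alpha>..\<beta>} w"
    and weak: "\<And>\<phi>. \<phi> \<in> test_functions \<alpha> \<beta> \<Longrightarrow> (LINT x|M. w x * deriv \<phi> x) = 0"
    and x: "x \<in> {\<alpha>..\<beta>}"
  shows "w x = w \<alpha>"
proof -
  let ?y = "(\<alpha> + \<beta>) / 2"
  have const: "w z = w ?y" if z: "z \<in> {\<alpha><..<\<beta>}" for z
  proof -
    have "\<alpha> < min z ?y" "max z ?y < \<beta>"
      using z interval by auto
    then obtain c d where cd: "\<alpha> < c" "c < min z ?y" "max z ?y < d" "d < \<beta>"
      by (meson dense)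
    have "\<exists>k. \<forall>x\<in>{c<..<d}. w x = k"
      by (rule weakly_constant_on_subinterval[OF cont weak]) (use cd in auto)
    moreover have "z \<in> {c<..<d}" "?y \<in> {c<..<d}"
      using cd by auto
    ultimately show ?thesis by metis
  qed
  have "w z = w ?y" if "z \<in> {\<alpha>..\<beta>}" for z
  proof (rule continuous_constant_on_closure[where f = w and S = "{\<alpha><..<\<beta>}"])
    show "continuous_on (closure {\<alpha><..<\<beta>}) w" "z \<in> closure {\<alpha><..<\<beta>}"
      using cont interval that by simp_all
  qed (rule const)
  from this[OF x] this[of \<alpha>] interval show ?thesis by simp
qed

lemma weak_derivative_imp_prim:
  assumes cont: "continuous_on {\<alpha>..\<beta>} u" and g: "g \<in> Lsq \<alpha> \<beta>"
    and weak: "has_weak_derivative \<alpha> \<beta> u g" and x: "x \<in> {\<alpha>..\<beta>}"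
  shows "u x = u \<alpha> + prim g x"
proof -
  have contp: "continuous_on {\<alpha>..\<beta>} (prim g)"
    by (rule continuous_on_subset[OF continuous_prim[OF Lsq_integrable[OF g]]]) simp
  have "u x - prim g x = u \<alpha> - prim g \<alpha>"
  proof (rule weakly_constant[OF _ _ x])
    show "continuous_on {\<alpha>..\<beta>} (\<lambda>x. u x - prim g x)"
      by (intro continuous_intros cont contp)
    fix \<phi> assume \<phi>: "\<phi> \<in> test_functions \<alpha> \<beta>"
    note L = deriv_test_function_Lsq[OF \<phi>]
    have "has_weak_derivative \<alpha> \<beta> (prim g) g"
      by (rule has_weak_derivative_prim[OF g, of _ 0]) simp
    then have "(LINT x|M. prim g x * deriv \<phi> x) = (LINT x|M. u x * deriv \<phi> x)"
      using weak \<phi> by (simp add: has_weak_derivative_def)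
    moreover have "(LINT x|M. (u x - prim g x) * deriv \<phi> x)
        = (LINT x|M. u x * deriv \<phi> x) - (LINT x|M. prim g x * deriv \<phi> x)"
      unfolding left_diff_distrib
      by (intro Bochner_Integration.integral_diff Lsq_mult_integrable L Lsq_continuous cont contp)
    ultimately show "(LINT x|M. (u x - prim g x) * deriv \<phi> x) = 0" by simp
  qed
  then show ?thesis by (simp add: prim_left)
qed

lemma H1_repD:
  assumes "u \<in> H1_rep \<alpha> \<beta>"
  shows "wderiv \<alpha> \<beta> u \<in> Lsq \<alpha> \<beta>" "has_weak_derivative \<alpha> \<beta> u (wderiv \<alpha> \<beta> u)"
    "continuous_on {\<alpha>..\<beta>} u" "u \<in> Lsq \<alpha> \<beta>" "\<And>x. x \<notin> {\<alpha>..\<beta>} \<Longrightarrow> u x = 0"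
proof -
  have "\<exists>g. g \<in> Lsq \<alpha> \<beta> \<and> has_weak_derivative \<alpha> \<beta> u g"
    using assms by (auto simp: H1_rep_def H1_def)
  from someI_ex[OF this] show "wderiv \<alpha> \<beta> u \<in> Lsq \<alpha> \<beta>" "has_weak_derivative \<alpha> \<beta> u (wderiv \<alpha> \<beta> u)"
    by (auto simp: wderiv_def)
  show "continuous_on {\<alpha>..\<beta>} u" "u \<in> Lsq \<alpha> \<beta>" "\<And>x. x \<notin> {\<alpha>..\<beta>} \<Longrightarrow> u x = 0"
    using assms by (auto simp: H1_rep_def H1_def)
qed

text \<open>Together with the next lemma this identifies \<open>H\<^sup>1\<close> with the constants plus the primitives of
  square-integrable functions, so that elements can be prescribed through their derivatives.\<close>

lemma H1_rep_eq_prim: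
  assumes "u \<in> H1_rep \<alpha> \<beta>" "x \<in> {\<alpha>..\<beta>}"
  shows "u x = u \<alpha> + prim (wderiv \<alpha> \<beta> u) x"
  using weak_derivative_imp_prim H1_repD[OF assms(1)] assms(2) by blast

lemma H1_rep_of_prim:
  assumes g: "g \<in> Lsq \<alpha> \<beta>" and u: "\<And>x. x \<in> {\<alpha>..\<beta>} \<Longrightarrow> u x = c + prim g x"
    and out: "\<And>x. x \<notin> {\<alpha>..\<beta>} \<Longrightarrow> u x = 0"
  shows "u \<in> H1_rep \<alpha> \<beta>" "AE x in M. wderiv \<alpha> \<beta> u x = g x"
proof -
  have contu: "continuous_on {\<alpha>..\<beta>} u"
  proof -
    have "continuous_on {\<alpha>..\<beta>} (\<lambda>x. c + prim g x)"
      by (intro continuous_intros continuous_on_subset[OF continuous_prim[OF Lsq_integrable[OF g]]]) simp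
    then show ?thesis by (rule continuous_on_eq) (simp add: u)
  qed
  have "has_weak_derivative \<alpha> \<beta> u g"
    by (rule has_weak_derivative_prim[OF g, of _ c]) (use u in simp)
  with g contu show H1: "u \<in> H1_rep \<alpha> \<beta>"
    by (auto simp: H1_rep_def H1_def out Lsq_continuous)
  let ?h = "wderiv \<alpha> \<beta> u"
  have h: "?h \<in> Lsq \<alpha> \<beta>" using H1_repD(1)[OF H1] .
  have "AE x in M. ?h x - g x = 0"
  proof (rule prim_eq_zero_imp_AE_zero)
    show "integrable M (\<lambda>x. ?h x - g x)"
      using Lsq_integrable[OF h] Lsq_integrable[OF g] by simp
    fix x assume x: "x \<in> {\<alpha>..\<beta>}"
    have "u \<alpha> = c" using u[of \<alpha>] interval by (simp add: prim_left)
    then have "prim ?h x = prim g x"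
      using H1_rep_eq_prim[OF H1 x] u[OF x] by simp
    then show "prim (\<lambda>x. ?h x - g x) x = 0"
      using prim_diff[OF Lsq_integrable[OF h] Lsq_integrable[OF g]] by simp
  qed
  then show "AE x in M. ?h x = g x" by simp
qed

lemma H1_rep_diff:
  assumes "u \<in> H1_rep \<alpha> \<beta>" "v \<in> H1_rep \<alpha> \<beta>"
  shows "(\<lambda>x. u x - v x) \<in> H1_rep \<alpha> \<beta>"
    "AE x in M. wderiv \<alpha> \<beta> (\<lambda>x. u x - v x) x = wderiv \<alpha> \<beta> u x - wderiv \<alpha> \<beta> v x"
proof -
  note L = H1_repD(1)[OF assms(1)] H1_repD(1)[OF assms(2)]
  have *: "u x - v x = u \<alpha> - v \<alpha> + prim (\<lambda>x. wderiv \<alpha> \<beta> u x - wderiv \<alpha> \<beta> v x) x" if "x \<in> {\<alpha>..\<beta>}" for x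
    using H1_rep_eq_prim[OF assms(1) that] H1_rep_eq_prim[OF assms(2) that]
      prim_diff[OF L[THEN Lsq_integrable]] by simp
  show "(\<lambda>x. u x - v x) \<in> H1_rep \<alpha> \<beta>"
    "AE x in M. wderiv \<alpha> \<beta> (\<lambda>x. u x - v x) x = wderiv \<alpha> \<beta> u x - wderiv \<alpha> \<beta> v x"
    using H1_rep_of_prim[OF Lsq_diff[OF L] *] H1_repD(5)[OF assms(1)] H1_repD(5)[OF assms(2)] by auto
qed


section \<open>Dependence on functions up to null sets\<close>

lemma prim_cong_AE:
  assumes f: "integrable M f" and g: "integrable M g" and eq: "AE x in M. f x = g x"
  shows "prim f = prim g"
proof
  note [measurable] = f[THEN borel_measurable_integrable] g[THEN borel_measurable_integrable]
  show "prim f x = prim g x" for x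
    unfolding prim_def
  proof (rule integral_cong_AE)
    show "AE y in M. indicator {..<x} y * f y = indicator {..<x} y * g y"
      using eq by eventually_elim simp
  qed simp_all
qed

lemma integral_mult_cong_AE:
  assumes f: "f \<in> Lsq \<alpha> \<beta>" and f': "f' \<in> Lsq \<alpha> \<beta>" and g: "g \<in> Lsq \<alpha> \<beta>" and g': "g' \<in> Lsq \<alpha> \<beta>"
    and eq: "AE x in M. f x = f' x" "AE x in M. g x = g' x"
  shows "(LINT x|M. f x * g x) = (LINT x|M. f' x * g' x)"
proof (rule integral_cong_AE)
  note [measurable] = f[THEN Lsq_measurable] f'[THEN Lsq_measurable] g[THEN Lsq_measurable] g'[THEN Lsq_measurable]
  show "(\<lambda>x. f x * g x) \<in> borel_measurable M" "(\<lambda>x. f' x * g' x) \<in> borel_measurable M"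
    by measurable
  show "AE x in M. f x * g x = f' x * g' x"
    using eq by eventually_elim simp
qed

lemma integral_cong_AE_Lsq:
  assumes f: "f \<in> Lsq \<alpha> \<beta>" and g: "g \<in> Lsq \<alpha> \<beta>" and eq: "AE x in M. f x = g x"
  shows "(LINT x|M. f x) = (LINT x|M. g x)"
  using integral_mult_cong_AE[OF f g Lsq_const[of 1] Lsq_const[of 1] eq] by simp

lemma integral_square_nonneg: "0 \<le> (LINT x|M. (f x)\<^sup>2)" for f :: "real \<Rightarrow> real"
  by simp

lemma integral_square_eq_0:
  assumes "f \<in> Lsq \<alpha> \<beta>" "(LINT x|M. (f x)\<^sup>2) = 0"
  shows "AE x in M. f x = 0"
proof -
  have "AE x in M. (f x)\<^sup>2 = 0"
    using integral_nonneg_eq_0_iff_AE[OF Lsq_square_integrable[OF assms(1)]] assms(2) by simp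
  then show ?thesis by simp
qed

text \<open>Completeness of Lebesgue measure. A constitutive law is regular only for almost every \<open>x\<close>, so its
  sublevel sets are known only up to null sets.\<close>

lemma sets_M_AE:
  assumes A: "A \<in> sets M" and B: "B \<subseteq> {\<alpha><..<\<beta>}" and AE: "AE x in M. x \<in> A \<longleftrightarrow> x \<in> B"
  shows "B \<in> sets M"
proof -
  have A': "A \<in> sets lebesgue" "A \<subseteq> {\<alpha><..<\<beta>}"
    using A by (simp_all add: sets_restrict_space_iff)
  have "AE x in lebesgue. x \<in> {\<alpha><..<\<beta>} \<longrightarrow> (x \<in> A \<longleftrightarrow> x \<in> B)"
    using AE by (simp add: AE_restrict_space_iff)
  then have "AE x in lebesgue. x \<notin> (A - B) \<union> (B - A)"
    by eventually_elim (use A'(2) B in blast)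
  then obtain N where N: "{x \<in> space lebesgue. \<not> x \<notin> (A - B) \<union> (B - A)} \<subseteq> N" "N \<in> null_sets lebesgue"
    unfolding eventually_ae_filter by blast
  then have "negligible N" by (simp only: negligible_iff_null_sets)
  then have "negligible ((A - B) \<union> (B - A))"
    by (rule negligible_subset) (use N(1) in auto)
  then have "B \<in> sets lebesgue"
    using A'(1) by (rule sets_negligible_symdiff[rotated])
  then show ?thesis using B by (simp add: sets_restrict_space_iff)
qed

end

section \<open>Strongly monotone constitutive laws\<close>

lemma lipschitz_imp_continuous_on:
  fixes f :: "real \<Rightarrow> real"
  assumes "\<And>x y. \<bar>f x - f y\<bar> \<le> K * \<bar>x - y\<bar>"
  shows "continuous_on S f"
proof (rule lipschitz_on_continuous_on[where L = "\<bar>K\<bar>"], rule lipschitz_onI)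
  \<comment> \<open>the absolute value supplies the nonnegative constant that the library notion asks for\<close>
  show "dist (f x) (f y) \<le> \<bar>K\<bar> * dist x y" for x y
    using order_trans[OF assms[of x y] mult_right_mono[OF abs_ge_self abs_ge_zero]]
    by (simp add: dist_real_def)
qed simp

lemma monotone_lipschitz_surj:
  fixes f :: "real \<Rightarrow> real"
  assumes mono: "\<And>r s. (f r - f s) * (r - s) \<ge> m * \<bar>r - s\<bar>\<^sup>2" and m: "m > 0"
    and lip: "\<And>r s. \<bar>f r - f s\<bar> \<le> K * \<bar>r - s\<bar>" and zero: "f 0 = 0"
  shows "\<exists>r. f r = y"
proof -
  have cont: "continuous_on S f" for S
    by (rule lipschitz_imp_continuous_on[OF lip])
  have growth: "m * r \<le> f r" if "r > 0" for r
  proof -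
    have "m * r * r \<le> f r * r" using mono[of r 0] that by (simp add: zero power2_eq_square)
    then show ?thesis using that by simp
  qed
  have decay: "f r \<le> m * r" if "r < 0" for r
  proof -
    have "m * r * r \<le> f r * r" using mono[of r 0] that by (simp add: zero power2_eq_square)
    then show ?thesis using that by simp
  qed
  show ?thesis
  proof (cases "y > 0")
    case True
    have "\<exists>r. 0 \<le> r \<and> r \<le> y / m \<and> f r = y"
      using True m growth[of "y / m"] zero by (intro IVT' cont) auto
    then show ?thesis by blast
  next
    case False
    show ?thesis
    proof (cases "y = 0")
      case True
      then show ?thesis using zero by blast
    next
      assume "y \<noteq> 0"
      then have neg: "y < 0" using False by simp
      have nonpos: "y / m < 0" using neg m by (simp add: divide_neg_pos)
      have "\<exists>r. y / m \<le> r \<and> r \<le> 0 \<and> f r = y"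
        using neg m decay[OF nonpos] zero nonpos by (intro IVT' cont) simp_all
      then show ?thesis by blast
    qed
  qed
qed

lemma strongly_monotone_less_iff:
  fixes f :: "real \<Rightarrow> real"
  assumes mono: "\<And>r s. (f r - f s) * (r - s) \<ge> m * \<bar>r - s\<bar>\<^sup>2" and m: "m > 0"
  shows "f r < f s \<longleftrightarrow> r < s"
proof -
  have less: "f r < f s" if "r < s" for r s
  proof -
    have "0 < m * \<bar>s - r\<bar>\<^sup>2" using that m by simp
    also have "\<dots> \<le> (f s - f r) * (s - r)" by (rule mono)
    finally show ?thesis using that by (simp add: zero_less_mult_iff)
  qed
  show ?thesis
    using less[of r s] less[of s r] by (cases r s rule: linorder_cases) auto
qed

locale flux_law = interval +
  fixes F :: "real \<Rightarrow> real \<Rightarrow> real" and m K :: real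
  assumes F_meas: "\<And>r. (\<lambda>x. F x r) \<in> borel_measurable M"
    and m_pos: "m > 0" and K_pos: "K > 0"
    and F_mono: "AE x in M. \<forall>r s. (F x r - F x s) * (r - s) \<ge> m * \<bar>r - s\<bar>\<^sup>2"
    and F_lip: "AE x in M. \<forall>r s. \<bar>F x r - F x s\<bar> \<le> K * \<bar>r - s\<bar>"
    and F_zero: "AE x in M. F x 0 = 0"
begin

lemma AE_F_less_iff: "AE x in M. \<forall>r s. F x r < F x s \<longleftrightarrow> r < s"
  using F_mono
proof eventually_elim
  case (elim x)
  then have "F x r < F x s \<longleftrightarrow> r < s" for r s
    using strongly_monotone_less_iff[of m "F x" r s] m_pos by blast
  then show ?case by blast
qed

text \<open>Pointwise inversion preserves measurability because \<open>F x\<close> is increasing for almost every \<open>x\<close>: the set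
  where \<open>g < c\<close> is, up to a null set, the set where \<open>h x < F x c\<close>, which involves \<open>F\<close> at the constant
  \<open>c\<close> only.\<close>

lemma inverse_measurable:
  assumes h: "h \<in> borel_measurable M"
  obtains g where "g \<in> borel_measurable M" "AE x in M. F x (g x) = h x"
proof
  define g where "g x = (SOME r. F x r = h x)" for x
  show *: "AE x in M. F x (g x) = h x"
    using F_mono F_lip F_zero
  proof eventually_elim
    case (elim x)
    then have "\<exists>r. F x r = h x"
      using monotone_lipschitz_surj[of m "F x" K "h x"] m_pos by blast
    then show ?case unfolding g_def by (rule someI_ex)
  qed
  show "g \<in> borel_measurable M"
    unfolding borel_measurable_iff_less
  proof
    fix c
    have "AE x in M. x \<in> {x \<in> space M. h x < F x c} \<longleftrightarrow> x \<in> {x \<in> space M. g x < c}"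
      using * AE_F_less_iff
    proof eventually_elim
      case (elim x)
      then have "h x < F x c \<longleftrightarrow> g x < c" by metis
      then show ?case by simp
    qed
    moreover have "{x \<in> space M. h x < F x c} \<in> sets M"
      using h F_meas[of c] by measurable
    moreover have "{x \<in> space M. g x < c} \<subseteq> {\<alpha><..<\<beta>}" by auto
    ultimately show "{x \<in> space M. g x < c} \<in> sets M"
      by (blast intro: sets_M_AE)
  qed
qed

text \<open>Measurability of Nemytskii operators, again from monotonicity: the inequality \<open>F x (g x) < c\<close> compares
  \<open>g\<close> with the inverse of the constant \<open>c\<close>, which is measurable by the previous lemma.\<close>

lemma composition_measurable:
  assumes g: "g \<in> borel_measurable M"
  shows "(\<lambda>x. F x (g x)) \<in> borel_measurable M"
  unfolding borel_measurable_iff_less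
proof
  fix c
  obtain k where k: "k \<in> borel_measurable M" "AE x in M. F x (k x) = c"
    using inverse_measurable[of "\<lambda>x. c"] by auto
  have "AE x in M. x \<in> {x \<in> space M. g x < k x} \<longleftrightarrow> x \<in> {x \<in> space M. F x (g x) < c}"
    using k(2) AE_F_less_iff
  proof eventually_elim
    case (elim x)
    then have "g x < k x \<longleftrightarrow> F x (g x) < c" by metis
    then show ?case by simp
  qed
  moreover have "{x \<in> space M. g x < k x} \<in> sets M"
    using g k(1) by measurable
  moreover have "{x \<in> space M. F x (g x) < c} \<subseteq> {\<alpha><..<\<beta>}" by auto
  ultimately show "{x \<in> space M. F x (g x) < c} \<in> sets M"
    by (blast intro: sets_M_AE)
qed

lemma composition_Lsq:
  assumes "g \<in> Lsq \<alpha> \<beta>"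
  shows "(\<lambda>x. F x (g x)) \<in> Lsq \<alpha> \<beta>"
proof (rule Lsq_dominated[OF assms composition_measurable[OF Lsq_measurable[OF assms]]])
  show "AE x in M. \<bar>F x (g x)\<bar> \<le> K * \<bar>g x\<bar>"
    using F_lip F_zero
  proof eventually_elim
    case (elim x)
    then have "\<bar>F x (g x) - F x 0\<bar> \<le> K * \<bar>g x - 0\<bar>" by blast
    then show ?case using elim by simp
  qed
qed

lemma AE_F_difference_bounds:
  "AE x in M. \<forall>r s. m * \<bar>r - s\<bar> \<le> \<bar>F x r - F x s\<bar>"
  using F_mono
proof eventually_elim
  case (elim x)
  show ?case
  proof (intro allI)
    fix r s
    have "m * \<bar>r - s\<bar> * \<bar>r - s\<bar> \<le> \<bar>(F x r - F x s) * (r - s)\<bar>"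
      using elim[rule_format, of r s] by (simp only: power2_eq_square mult.assoc)
    then have *: "m * \<bar>r - s\<bar> * \<bar>r - s\<bar> \<le> \<bar>F x r - F x s\<bar> * \<bar>r - s\<bar>"
      by (simp only: abs_mult)
    show "m * \<bar>r - s\<bar> \<le> \<bar>F x r - F x s\<bar>"
    proof (cases "r = s")
      case False
      with mult_right_le_imp_le[OF *] show ?thesis by simp
    qed simp
  qed
qed

lemma inverse_Lsq:
  assumes h: "h \<in> Lsq \<alpha> \<beta>"
  obtains g where "g \<in> Lsq \<alpha> \<beta>" "AE x in M. F x (g x) = h x"
proof -
  obtain g where g: "g \<in> borel_measurable M" "AE x in M. F x (g x) = h x"
    using inverse_measurable[OF Lsq_measurable[OF h]] by blast
  have "g \<in> Lsq \<alpha> \<beta>"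
  proof (rule Lsq_dominated[OF h g(1)])
    show "AE x in M. \<bar>g x\<bar> \<le> 1 / m * \<bar>h x\<bar>"
      using g(2) F_zero AE_F_difference_bounds
    proof eventually_elim
      case (elim x)
      from elim(3)[rule_format, of "g x" 0] have "m * \<bar>g x\<bar> \<le> \<bar>h x\<bar>"
        by (simp add: elim)
      then show ?case using m_pos by (simp add: field_simps)
    qed
  qed
  with g(2) that show ?thesis by blast
qed

text \<open>Lowering the prescribed force by a constant lowers the strain by an amount controlled from both
  sides. These bounds make the gap a bi-Lipschitz function of the contact force.\<close>

lemma shifted_flux_bounds:
  assumes "AE x in M. F x (g x) = h x - s" "AE x in M. F x (g' x) = h x - s'" and "s \<le> s'"
  shows "AE x in M. (s' - s) / K \<le> g x - g' x \<and> g x - g' x \<le> (s' - s) / m"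
  using assms(1,2) F_lip AE_F_difference_bounds AE_F_less_iff
proof eventually_elim
  case (elim x)
  have diff: "F x (g x) - F x (g' x) = s' - s" using elim by simp
  have "\<not> g x < g' x" using elim assms(3) by (metis diff diff_ge_0_iff_ge not_less)
  then have nonneg: "g x - g' x \<ge> 0" by simp
  have 1: "s' - s \<le> K * (g x - g' x)"
    using elim(3)[rule_format, of "g x" "g' x"] nonneg assms(3) unfolding diff by simp
  have 2: "m * (g x - g' x) \<le> s' - s"
    using elim(4)[rule_format, of "g x" "g' x"] nonneg assms(3) unfolding diff by simp
  show ?case
    using 1 2 m_pos K_pos by (simp add: field_simps)
qed

lemma shifted_flux_integral_bounds:
  assumes g: "g \<in> Lsq \<alpha> \<beta>" and g': "g' \<in> Lsq \<alpha> \<beta>"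
    and "AE x in M. F x (g x) = h x - s" "AE x in M. F x (g' x) = h x - s'" and "s \<le> s'"
  shows "(s' - s) * ((\<beta> - \<alpha>) / K) \<le> (LINT x|M. g x) - (LINT x|M. g' x)"
    and "(LINT x|M. g x) - (LINT x|M. g' x) \<le> (s' - s) * ((\<beta> - \<alpha>) / m)"
proof -
  note bounds = shifted_flux_bounds[OF assms(3-5)]
  note I = Lsq_integrable[OF g] Lsq_integrable[OF g']
  have eq: "(LINT x|M. g x) - (LINT x|M. g' x) = (LINT x|M. g x - g' x)"
    using I by simp
  have c: "(LINT x|M. c) = c * (\<beta> - \<alpha>)" for c :: real
    using measure_M by simp
  have "(LINT x|M. (s' - s) / K) \<le> (LINT x|M. g x - g' x)"
    by (rule integral_mono_AE) (use bounds I in \<open>auto elim: AE_mp\<close>)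
  then show "(s' - s) * ((\<beta> - \<alpha>) / K) \<le> (LINT x|M. g x) - (LINT x|M. g' x)"
    unfolding eq c by simp
  have "(LINT x|M. g x - g' x) \<le> (LINT x|M. (s' - s) / m)"
    by (rule integral_mono_AE) (use bounds I in \<open>auto elim: AE_mp\<close>)
  then show "(LINT x|M. g x) - (LINT x|M. g' x) \<le> (s' - s) * ((\<beta> - \<alpha>) / m)"
    unfolding eq c by simp
qed

lemma shifted_flux_norm_bound:
  assumes g: "g \<in> Lsq \<alpha> \<beta>" and g': "g' \<in> Lsq \<alpha> \<beta>"
    and flux: "AE x in M. F x (g x) = h x - s" "AE x in M. F x (g' x) = h x - s'"
  shows "(LINT x|M. (g x - g' x)\<^sup>2) \<le> (s - s')\<^sup>2 * ((\<beta> - \<alpha>) / m\<^sup>2)"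
proof -
  have "(LINT x|M. (g x - g' x)\<^sup>2) \<le> (LINT x|M. ((s - s') / m)\<^sup>2)"
  proof (rule integral_mono_AE)
    show "AE x in M. (g x - g' x)\<^sup>2 \<le> ((s - s') / m)\<^sup>2"
      using flux AE_F_difference_bounds
    proof eventually_elim
      case (elim x)
      have diff: "F x (g x) - F x (g' x) = s' - s" using elim by simp
      have "m * \<bar>g x - g' x\<bar> \<le> \<bar>s' - s\<bar>"
        using elim(3)[rule_format, of "g x" "g' x"] unfolding diff .
      then have "\<bar>g x - g' x\<bar> \<le> \<bar>(s - s') / m\<bar>"
        using m_pos by (simp add: field_simps abs_minus_commute)
      then show ?case by (rule abs_le_square_iff[THEN iffD1])
    qed
  qed (use Lsq_square_integrable[OF Lsq_diff[OF g g']] in simp_all)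
  also have "\<dots> = (s - s')\<^sup>2 * ((\<beta> - \<alpha>) / m\<^sup>2)"
    using measure_M by (simp add: power_divide)
  finally show ?thesis .
qed

end

section \<open>The space V and its Riesz representatives\<close>

locale gap =
  fixes a l b :: real
  assumes left_length: "a < - l" and l_pos: "0 < l" and right_length: "l < b"

sublocale gap \<subseteq> left: interval a "- l"
  by unfold_locales (rule left_length)

sublocale gap \<subseteq> right: interval l b
  by unfold_locales (rule right_length)

context gap
begin

abbreviation D1 :: "fpair \<Rightarrow> real \<Rightarrow> real" where "D1 v \<equiv> wderiv a (- l) (fst v)"
abbreviation D2 :: "fpair \<Rightarrow> real \<Rightarrow> real" where "D2 v \<equiv> wderiv l b (snd v)"

lemma V_iff: "v \<in> V a l b \<longleftrightarrow> fst v \<in> H1_rep a (- l) \<and> fst v a = 0 \<and> snd v \<in> H1_rep l b \<and> snd v b = 0"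
  by (cases v) (auto simp: V_def V1_def V2_def)

lemma D1_Lsq: "v \<in> V a l b \<Longrightarrow> D1 v \<in> Lsq a (- l)"
  by (simp add: V_iff left.H1_repD(1))

lemma D2_Lsq: "v \<in> V a l b \<Longrightarrow> D2 v \<in> Lsq l b"
  by (simp add: V_iff right.H1_repD(1))

lemma V_components:
  assumes "v \<in> V a l b"
  shows "x \<in> {a..- l} \<Longrightarrow> fst v x = left.prim (D1 v) x"
    and "x \<in> {l..b} \<Longrightarrow> snd v x = right.prim (D2 v) x - (LINT y|right.M. D2 v y)"
proof -
  show "fst v x = left.prim (D1 v) x" if "x \<in> {a..- l}"
    using left.H1_rep_eq_prim[of "fst v" x] assms that by (simp add: V_iff)
  show "snd v x = right.prim (D2 v) x - (LINT y|right.M. D2 v y)" if "x \<in> {l..b}"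
    using right.H1_rep_eq_prim[of "snd v" x] right.H1_rep_eq_prim[of "snd v" b] assms that right_length
    by (simp add: V_iff right.prim_right)
qed

lemma V_traces:
  assumes "v \<in> V a l b"
  shows "fst v (- l) = (LINT x|left.M. D1 v x)" "snd v l = - (LINT x|right.M. D2 v x)"
  using V_components(1)[OF assms, of "- l"] V_components(2)[OF assms, of l] left_length right_length
  by (simp_all add: left.prim_right right.prim_left)

lemma \<theta>_eq:
  assumes "v \<in> V a l b"
  shows "\<theta> l v = 2 * l - (LINT x|left.M. D1 v x) - (LINT x|right.M. D2 v x)"
  using V_traces[OF assms] by (simp add: \<theta>_def)

text \<open>An element of \<open>V\<close> is the same as a pair of square-integrable functions: the outer ends are fixed, so
  each component is the primitive of its derivative that vanishes there.\<close>

lemma V_of_derivatives: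
  assumes g1: "g1 \<in> Lsq a (- l)" and g2: "g2 \<in> Lsq l b"
  obtains v where "v \<in> V a l b" "AE x in left.M. D1 v x = g1 x" "AE x in right.M. D2 v x = g2 x"
proof -
  define v1 where "v1 x = (if x \<in> {a..- l} then 0 + left.prim g1 x else 0)" for x
  define v2 where "v2 x = (if x \<in> {l..b} then - (LINT y|right.M. g2 y) + right.prim g2 x else 0)" for x
  have 1: "v1 \<in> H1_rep a (- l)" "AE x in left.M. wderiv a (- l) v1 x = g1 x"
    by (rule left.H1_rep_of_prim[OF g1]; auto simp: v1_def)+
  have 2: "v2 \<in> H1_rep l b" "AE x in right.M. wderiv l b v2 x = g2 x"
    by (rule right.H1_rep_of_prim[OF g2]; auto simp: v2_def)+
  have "(v1, v2) \<in> V a l b"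
    using 1(1) 2(1) left_length right_length
    by (simp add: V_iff v1_def v2_def left.prim_left right.prim_right)
  with 1(2) 2(2) that[of "(v1, v2)"] show ?thesis by simp
qed

lemma V_diff:
  assumes "u \<in> V a l b" "v \<in> V a l b"
  shows "u - v \<in> V a l b" "AE x in left.M. D1 (u - v) x = D1 u x - D1 v x"
    "AE x in right.M. D2 (u - v) x = D2 u x - D2 v x"
  using left.H1_rep_diff[of "fst u" "fst v"] right.H1_rep_diff[of "snd u" "snd v"] assms
  by (simp_all add: V_iff fun_diff_def)

lemma V_inner_eq:
  assumes u: "u \<in> V a l b" and v: "v \<in> V a l b"
    and g: "g1 \<in> Lsq a (- l)" "g2 \<in> Lsq l b"
    and eq: "AE x in left.M. D1 u x = g1 x" "AE x in right.M. D2 u x = g2 x"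
  shows "V_inner a l b u v = (LINT x|left.M. g1 x * D1 v x) + (LINT x|right.M. g2 x * D2 v x)"
proof -
  have "(LINT x|left.M. D1 u x * D1 v x) = (LINT x|left.M. g1 x * D1 v x)"
    by (rule left.integral_mult_cong_AE[OF D1_Lsq[OF u] g(1) D1_Lsq[OF v] D1_Lsq[OF v] eq(1)]) simp
  moreover have "(LINT x|right.M. D2 u x * D2 v x) = (LINT x|right.M. g2 x * D2 v x)"
    by (rule right.integral_mult_cong_AE[OF D2_Lsq[OF u] g(2) D2_Lsq[OF v] D2_Lsq[OF v] eq(2)]) simp
  ultimately show ?thesis by (simp add: V_inner_def)
qed

lemma V_eqI:
  assumes u: "u \<in> V a l b" and v: "v \<in> V a l b"
    and eq: "AE x in left.M. D1 u x = D1 v x" "AE x in right.M. D2 u x = D2 v x"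
  shows "u = v"
proof (rule prod_eqI; rule ext)
  fix x
  have p1: "left.prim (D1 u) = left.prim (D1 v)"
    by (rule left.prim_cong_AE[OF left.Lsq_integrable[OF D1_Lsq[OF u]] left.Lsq_integrable[OF D1_Lsq[OF v]] eq(1)])
  have p2: "right.prim (D2 u) = right.prim (D2 v)"
    by (rule right.prim_cong_AE[OF right.Lsq_integrable[OF D2_Lsq[OF u]] right.Lsq_integrable[OF D2_Lsq[OF v]] eq(2)])
  have i2: "(LINT y|right.M. D2 u y) = (LINT y|right.M. D2 v y)"
    by (rule right.integral_cong_AE_Lsq[OF D2_Lsq[OF u] D2_Lsq[OF v] eq(2)])
  show "fst u x = fst v x"
  proof (cases "x \<in> {a..- l}")
    case True
    then show ?thesis using V_components(1)[OF u True] V_components(1)[OF v True] p1 by simp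
  next
    case False
    then show ?thesis using u v left.H1_repD(5)[of "fst u" x] left.H1_repD(5)[of "fst v" x] by (simp add: V_iff)
  qed
  show "snd u x = snd v x"
  proof (cases "x \<in> {l..b}")
    case True
    then show ?thesis using V_components(2)[OF u True] V_components(2)[OF v True] p2 i2 by simp
  next
    case False
    then show ?thesis using u v right.H1_repD(5)[of "snd u" x] right.H1_repD(5)[of "snd v" x] by (simp add: V_iff)
  qed
qed

text \<open>A functional that is given by densities against the derivatives is represented by the element
  with these densities as derivatives. All functionals of the problem have this form.\<close>

lemma riesz_inner:
  assumes g: "g1 \<in> Lsq a (- l)" "g2 \<in> Lsq l b"
    and \<Phi>: "\<And>v. v \<in> V a l b \<Longrightarrow> \<Phi> v = (LINT x|left.M. g1 x * D1 v x) + (LINT x|right.M. g2 x * D2 v x)"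
    and v: "v \<in> V a l b"
  shows "V_inner a l b (riesz a l b \<Phi>) v = \<Phi> v"
proof -
  let ?P = "\<lambda>w. w \<in> V a l b \<and> (\<forall>v\<in>V a l b. V_inner a l b w v = \<Phi> v)"
  obtain w where w: "w \<in> V a l b" "AE x in left.M. D1 w x = g1 x" "AE x in right.M. D2 w x = g2 x"
    using V_of_derivatives[OF g] by blast
  have Pw: "?P w"
    using w V_inner_eq[OF w(1) _ g w(2,3)] \<Phi> by simp
  have "w' = w" if "?P w'" for w'
  proof -
    have w': "w' \<in> V a l b" using that by blast
    note D = V_diff[OF w' w(1)]
    let ?d = "w' - w"
    note L1 = D1_Lsq[OF w'] D1_Lsq[OF w(1)] D1_Lsq[OF D(1)]
    note L2 = D2_Lsq[OF w'] D2_Lsq[OF w(1)] D2_Lsq[OF D(1)]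
    have "V_inner a l b w' ?d - V_inner a l b w ?d = 0"
      using that Pw D(1) by simp
    moreover have "(LINT x|left.M. D1 w' x * D1 ?d x) - (LINT x|left.M. D1 w x * D1 ?d x) = (LINT x|left.M. (D1 ?d x)\<^sup>2)"
    proof -
      have "(LINT x|left.M. D1 w' x * D1 ?d x) - (LINT x|left.M. D1 w x * D1 ?d x)
          = (LINT x|left.M. (D1 w' x - D1 w x) * D1 ?d x)"
        unfolding left_diff_distrib
        by (rule Bochner_Integration.integral_diff[symmetric]; intro left.Lsq_mult_integrable L1)
      also have "\<dots> = (LINT x|left.M. D1 ?d x * D1 ?d x)"
        by (rule left.integral_mult_cong_AE[OF left.Lsq_diff[OF L1(1,2)] L1(3) L1(3) L1(3)]) (use D(2) in auto)
      finally show ?thesis by (simp add: power2_eq_square)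
    qed
    moreover have "(LINT x|right.M. D2 w' x * D2 ?d x) - (LINT x|right.M. D2 w x * D2 ?d x) = (LINT x|right.M. (D2 ?d x)\<^sup>2)"
    proof -
      have "(LINT x|right.M. D2 w' x * D2 ?d x) - (LINT x|right.M. D2 w x * D2 ?d x)
          = (LINT x|right.M. (D2 w' x - D2 w x) * D2 ?d x)"
        unfolding left_diff_distrib
        by (rule Bochner_Integration.integral_diff[symmetric]; intro right.Lsq_mult_integrable L2)
      also have "\<dots> = (LINT x|right.M. D2 ?d x * D2 ?d x)"
        by (rule right.integral_mult_cong_AE[OF right.Lsq_diff[OF L2(1,2)] L2(3) L2(3) L2(3)]) (use D(3) in auto)
      finally show ?thesis by (simp add: power2_eq_square)
    qed
    ultimately have "(LINT x|left.M. (D1 ?d x)\<^sup>2) + (LINT x|right.M. (D2 ?d x)\<^sup>2) = 0"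
      unfolding V_inner_def by linarith
    then have "(LINT x|left.M. (D1 ?d x)\<^sup>2) = 0" "(LINT x|right.M. (D2 ?d x)\<^sup>2) = 0"
      using left.integral_square_nonneg[of "D1 ?d"] right.integral_square_nonneg[of "D2 ?d"] by linarith+
    then have "AE x in left.M. D1 ?d x = 0" "AE x in right.M. D2 ?d x = 0"
      using left.integral_square_eq_0[OF L1(3)] right.integral_square_eq_0[OF L2(3)] by simp_all
    then have "AE x in left.M. D1 w' x = D1 w x" "AE x in right.M. D2 w' x = D2 w x"
      using D(2,3) by (auto elim: AE_mp)
    then show ?thesis by (rule V_eqI[OF w' w(1)])
  qed
  with Pw have "?P (THE w. ?P w)" by (rule theI)
  with v show ?thesis by (simp add: riesz_def)
qed

end

section \<open>Reduction to a scalar inequality\<close>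

locale gap_problem =
  gap a l b + left: flux_law a "- l" F1 m1 M1 + right: flux_law l b F2 m2 M2
  for a l b F1 m1 M1 F2 m2 M2 +
  fixes f1 f2 :: "real \<Rightarrow> real"
  assumes f1: "f1 \<in> Lsq a (- l)" and f2: "f2 \<in> Lsq l b"
begin

text \<open>The loads after integration by parts: \<open>load1 x\<close> is the integral of \<open>f1\<close> from \<open>x\<close> to the contact end
  \<open>-l\<close>, and \<open>load2 x\<close> is minus the integral of \<open>f2\<close> from the contact end \<open>l\<close> to \<open>x\<close>. Thus both
  are the resultant force transmitted through \<open>x\<close> when the contact ends are free.\<close>

definition load1 :: "real \<Rightarrow> real" where
  "load1 x = (LINT y|left.M. f1 y) - left.prim f1 x"

definition load2 :: "real \<Rightarrow> real" where
  "load2 x = - right.prim f2 x"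

lemma load1_Lsq: "load1 \<in> Lsq a (- l)"
  unfolding load1_def by (intro left.Lsq_diff left.Lsq_const left.prim_Lsq left.Lsq_integrable f1)

lemma load2_Lsq: "load2 \<in> Lsq l b"
  using right.Lsq_cmult[OF right.prim_Lsq[OF right.Lsq_integrable[OF f2]], of "-1"]
  by (simp add: load2_def[abs_def])

lemma inner_A:
  assumes u: "u \<in> V a l b" and v: "v \<in> V a l b"
  shows "V_inner a l b (opA a l b F1 F2 u) v =
    (LINT x|left.M. F1 x (D1 u x) * D1 v x) + (LINT x|right.M. F2 x (D2 u x) * D2 v x)"
  unfolding opA_def
  by (rule riesz_inner[OF left.composition_Lsq[OF D1_Lsq[OF u]] right.composition_Lsq[OF D2_Lsq[OF u]] refl v])

lemma inner_G:
  assumes v: "v \<in> V a l b"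
  shows "V_inner a l b (opG a l b q u) v = q (\<theta> l u) * (2 * l - \<theta> l v)"
proof -
  have "V_inner a l b (opG a l b q u) v = q (\<theta> l u) * fst v (- l) - q (\<theta> l u) * snd v l"
    unfolding opG_def
    by (rule riesz_inner[OF left.Lsq_const[of "q (\<theta> l u)"] right.Lsq_const[of "q (\<theta> l u)"] _ v])
       (simp add: V_traces)
  then show ?thesis by (simp add: \<theta>_def algebra_simps)
qed

lemma inner_f:
  assumes v: "v \<in> V a l b"
  shows "V_inner a l b (elt_f a l b f1 f2) v =
    (LINT x|left.M. load1 x * D1 v x) + (LINT x|right.M. load2 x * D2 v x)"
proof -
  have *: "(LINT x|left.M. f1 x * fst w x) + (LINT x|right.M. f2 x * snd w x) =
     (LINT x|left.M. load1 x * D1 w x) + (LINT x|right.M. load2 x * D2 w x)" if w: "w \<in> V a l b" for w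
  proof -
    note I1 = left.Lsq_integrable[OF f1] left.Lsq_integrable[OF D1_Lsq[OF w]]
    note I2 = right.Lsq_integrable[OF f2] right.Lsq_integrable[OF D2_Lsq[OF w]]
    note P1 = left.Lsq_mult_integrable[OF D1_Lsq[OF w] left.prim_Lsq[OF I1(1)]]
    note P2 = right.Lsq_mult_integrable[OF f2 right.prim_Lsq[OF I2(2)]]
    have "(LINT x|left.M. f1 x * fst w x) = (LINT x|left.M. f1 x * left.prim (D1 w) x)"
      by (intro Bochner_Integration.integral_cong) (simp_all add: V_components(1)[OF w])
    also have "\<dots> = (LINT x|left.M. f1 x) * (LINT x|left.M. D1 w x) - (LINT x|left.M. D1 w x * left.prim f1 x)"
      using left.prim_by_parts[OF I1] by simp
    also have "\<dots> = (LINT x|left.M. (LINT x|left.M. f1 x) * D1 w x - D1 w x * left.prim f1 x)"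
      using I1 P1 by simp
    also have "\<dots> = (LINT x|left.M. load1 x * D1 w x)"
      by (simp add: load1_def left_diff_distrib mult.commute[of "D1 w _"])
    finally have e1: "(LINT x|left.M. f1 x * fst w x) = (LINT x|left.M. load1 x * D1 w x)" .
    have "(LINT x|right.M. f2 x * snd w x)
        = (LINT x|right.M. f2 x * right.prim (D2 w) x - f2 x * (LINT x|right.M. D2 w x))"
      by (intro Bochner_Integration.integral_cong) (simp_all add: V_components(2)[OF w] right_diff_distrib)
    also have "\<dots> = (LINT x|right.M. f2 x * right.prim (D2 w) x) - (LINT x|right.M. f2 x) * (LINT x|right.M. D2 w x)"
      using I2 P2 by simp
    also have "\<dots> = - (LINT x|right.M. D2 w x * right.prim f2 x)"
      using right.prim_by_parts[OF I2] by simp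
    also have "\<dots> = (LINT x|right.M. load2 x * D2 w x)"
      by (simp add: load2_def mult.commute)
    finally show ?thesis using e1 by simp
  qed
  have "V_inner a l b (elt_f a l b f1 f2) v = (LINT x|left.M. f1 x * fst v x) + (LINT x|right.M. f2 x * snd v x)"
    unfolding elt_f_def by (rule riesz_inner[OF load1_Lsq load2_Lsq * v])
  then show ?thesis using *[OF v] by simp
qed

text \<open>The force in both rods differs from the free one by the same constant \<open>s\<close>, the reaction at the
  contact ends. Equivalently, the residual of \<open>u\<close> is \<open>s\<close> times the linear part of \<open>\<theta>\<close>.\<close>

definition has_flux :: "fpair \<Rightarrow> real \<Rightarrow> bool" where
  "has_flux u s \<longleftrightarrow> u \<in> V a l b \<and> (AE x in left.M. F1 x (D1 u x) = load1 x - s) \<and>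
     (AE x in right.M. F2 x (D2 u x) = load2 x - s)"

lemma residual_eq:
  assumes u: "u \<in> V a l b" and w: "w \<in> V a l b"
    and g: "g1 \<in> Lsq a (- l)" "g2 \<in> Lsq l b" "AE x in left.M. D1 w x = g1 x" "AE x in right.M. D2 w x = g2 x"
    and e: "e1 \<in> Lsq a (- l)" "e2 \<in> Lsq l b" 
      "AE x in left.M. F1 x (D1 u x) - load1 x = e1 x" "AE x in right.M. F2 x (D2 u x) - load2 x = e2 x"
  shows "V_inner a l b (opA a l b F1 F2 u) w - V_inner a l b (elt_f a l b f1 f2) w =
    (LINT x|left.M. e1 x * g1 x) + (LINT x|right.M. e2 x * g2 x)"
proof -
  note A1 = left.composition_Lsq[OF D1_Lsq[OF u]] and A2 = right.composition_Lsq[OF D2_Lsq[OF u]]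
  have "(LINT x|left.M. F1 x (D1 u x) * D1 w x) - (LINT x|left.M. load1 x * D1 w x)
      = (LINT x|left.M. (F1 x (D1 u x) - load1 x) * D1 w x)"
    unfolding left_diff_distrib
    by (rule Bochner_Integration.integral_diff[symmetric]; intro left.Lsq_mult_integrable A1 load1_Lsq D1_Lsq w)
  also have "\<dots> = (LINT x|left.M. e1 x * g1 x)"
    by (rule left.integral_mult_cong_AE[OF left.Lsq_diff[OF A1 load1_Lsq] e(1) D1_Lsq[OF w] g(1) e(3) g(3)])
  finally have 1: "(LINT x|left.M. F1 x (D1 u x) * D1 w x) - (LINT x|left.M. load1 x * D1 w x) = (LINT x|left.M. e1 x * g1 x)" .
  have "(LINT x|right.M. F2 x (D2 u x) * D2 w x) - (LINT x|right.M. load2 x * D2 w x)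
      = (LINT x|right.M. (F2 x (D2 u x) - load2 x) * D2 w x)"
    unfolding left_diff_distrib
    by (rule Bochner_Integration.integral_diff[symmetric]; intro right.Lsq_mult_integrable A2 load2_Lsq D2_Lsq w)
  also have "\<dots> = (LINT x|right.M. e2 x * g2 x)"
    by (rule right.integral_mult_cong_AE[OF right.Lsq_diff[OF A2 load2_Lsq] e(2) D2_Lsq[OF w] g(2) e(4) g(4)])
  finally show ?thesis using 1 by (simp add: inner_A[OF u w] inner_f[OF w])
qed

lemma residual_of_flux:
  assumes "has_flux u s" and v: "v \<in> V a l b"
  shows "V_inner a l b (opA a l b F1 F2 u) (v - u) - V_inner a l b (elt_f a l b f1 f2) (v - u) = s * (\<theta> l v - \<theta> l u)"
proof -
  have u: "u \<in> V a l b"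
    and flux: "AE x in left.M. F1 x (D1 u x) - load1 x = - s" "AE x in right.M. F2 x (D2 u x) - load2 x = - s"
    using assms(1) by (auto simp: has_flux_def elim: AE_mp)
  note D = V_diff[OF v u]
  have "V_inner a l b (opA a l b F1 F2 u) (v - u) - V_inner a l b (elt_f a l b f1 f2) (v - u)
      = (LINT x|left.M. - s * (D1 v x - D1 u x)) + (LINT x|right.M. - s * (D2 v x - D2 u x))"
    by (rule residual_eq[OF u D(1) left.Lsq_diff[OF D1_Lsq[OF v] D1_Lsq[OF u]]
          right.Lsq_diff[OF D2_Lsq[OF v] D2_Lsq[OF u]] D(2,3) left.Lsq_const right.Lsq_const flux])
  also have "\<dots> = s * (\<theta> l v - \<theta> l u)"
    using left.Lsq_integrable[OF D1_Lsq[OF v]] left.Lsq_integrable[OF D1_Lsq[OF u]]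
      right.Lsq_integrable[OF D2_Lsq[OF v]] right.Lsq_integrable[OF D2_Lsq[OF u]]
    by (simp add: \<theta>_eq[OF u] \<theta>_eq[OF v] algebra_simps)
  finally show ?thesis .
qed

lemma \<theta>_surj: obtains v where "v \<in> V a l b" "\<theta> l v = r"
proof -
  let ?c = "(2 * l - r) / (- l - a)"
  obtain v where v: "v \<in> V a l b" "AE x in left.M. D1 v x = ?c" "AE x in right.M. D2 v x = 0"
    using V_of_derivatives[OF left.Lsq_const[of ?c] right.Lsq_const[of 0]] by blast
  have "(LINT x|left.M. D1 v x) = ?c * (- l - a)"
    using left.integral_cong_AE_Lsq[OF D1_Lsq[OF v(1)] left.Lsq_const v(2)] left.measure_M by simp
  moreover have "(LINT x|right.M. D2 v x) = 0"
    using right.integral_cong_AE_Lsq[OF D2_Lsq[OF v(1)] right.Lsq_const v(3)] by simp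
  ultimately have "\<theta> l v = r"
    using \<theta>_eq[OF v(1)] left_length by simp
  with v(1) that show ?thesis by blast
qed

text \<open>Varying \<open>u\<close> without changing the gap keeps it admissible and removes the right-hand side, so the
  residual \<open>(e1, e2)\<close> has nonnegative pairing with every pair of derivatives of total integral zero.
  The negative \<open>(- d1, - d2)\<close> of its deviation from the mean \<open>k\<close> is such a pair, and the pairing is
  then minus the squared norm of the deviation.\<close>

lemma flux_of_inequality:
  assumes u: "u \<in> V a l b" "\<theta> l u \<in> Z"
    and ineq: "\<And>v. v \<in> V a l b \<Longrightarrow> \<theta> l v \<in> Z \<Longrightarrow>
      V_inner a l b (opA a l b F1 F2 u) (v - u) - V_inner a l b (elt_f a l b f1 f2) (v - u) \<ge> c * (\<theta> l v - \<theta> l u)"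
  obtains s where "has_flux u s"
proof -
  define e1 where "e1 x = F1 x (D1 u x) - load1 x" for x
  define e2 where "e2 x = F2 x (D2 u x) - load2 x" for x
  have e1: "e1 \<in> Lsq a (- l)"
    unfolding e1_def by (intro left.Lsq_diff left.composition_Lsq D1_Lsq u load1_Lsq)
  have e2: "e2 \<in> Lsq l b"
    unfolding e2_def by (intro right.Lsq_diff right.composition_Lsq D2_Lsq u load2_Lsq)
  define k where "k = ((LINT x|left.M. e1 x) + (LINT x|right.M. e2 x)) / ((- l - a) + (b - l))"
  define d1 where "d1 x = e1 x - k" for x
  define d2 where "d2 x = e2 x - k" for x
  have d1: "d1 \<in> Lsq a (- l)" and d2: "d2 \<in> Lsq l b"
    unfolding d1_def d2_def by (intro left.Lsq_diff left.Lsq_const e1 right.Lsq_diff right.Lsq_const e2)+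
  note I = left.Lsq_integrable[OF e1] right.Lsq_integrable[OF e2] left.Lsq_integrable[OF d1] right.Lsq_integrable[OF d2]
    left.Lsq_integrable[OF D1_Lsq[OF u(1)]] right.Lsq_integrable[OF D2_Lsq[OF u(1)]]
  have "(LINT x|left.M. d1 x) = (LINT x|left.M. e1 x) - k * (- l - a)"
    "(LINT x|right.M. d2 x) = (LINT x|right.M. e2 x) - k * (b - l)"
    unfolding d1_def d2_def using I left.measure_M right.measure_M by (simp_all add: mult.commute)
  moreover have "k * ((- l - a) + (b - l)) = (LINT x|left.M. e1 x) + (LINT x|right.M. e2 x)"
    unfolding k_def using left_length right_length by simp
  ultimately have mean: "(LINT x|left.M. d1 x) + (LINT x|right.M. d2 x) = 0"
    by (simp only: distrib_left)
  note L1 = left.Lsq_diff[OF D1_Lsq[OF u(1)] d1] and L2 = right.Lsq_diff[OF D2_Lsq[OF u(1)] d2]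
  obtain v where v: "v \<in> V a l b" "AE x in left.M. D1 v x = D1 u x - d1 x" "AE x in right.M. D2 v x = D2 u x - d2 x"
    using V_of_derivatives[OF L1 L2] by blast
  note D = V_diff[OF v(1) u(1)]
  have n1: "(\<lambda>x. - d1 x) \<in> Lsq a (- l)" and n2: "(\<lambda>x. - d2 x) \<in> Lsq l b"
    using left.Lsq_cmult[OF d1, of "-1"] right.Lsq_cmult[OF d2, of "-1"] by simp_all
  have w1: "AE x in left.M. D1 (v - u) x = - d1 x"
    using v(2) D(2) by eventually_elim simp
  have w2: "AE x in right.M. D2 (v - u) x = - d2 x"
    using v(3) D(3) by eventually_elim simp
  have "\<theta> l v = \<theta> l u + ((LINT x|left.M. d1 x) + (LINT x|right.M. d2 x))"
    using left.integral_cong_AE_Lsq[OF D1_Lsq[OF v(1)] L1 v(2)] right.integral_cong_AE_Lsq[OF D2_Lsq[OF v(1)] L2 v(3)] I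
    by (simp add: \<theta>_eq[OF v(1)] \<theta>_eq[OF u(1)])
  then have \<theta>: "\<theta> l v = \<theta> l u" using mean by simp
  have "0 \<le> V_inner a l b (opA a l b F1 F2 u) (v - u) - V_inner a l b (elt_f a l b f1 f2) (v - u)"
    using ineq[OF v(1)] u(2) \<theta> by simp
  also have "\<dots> = (LINT x|left.M. e1 x * - d1 x) + (LINT x|right.M. e2 x * - d2 x)"
    by (rule residual_eq[OF u(1) D(1) n1 n2 w1 w2 e1 e2]) (simp_all add: e1_def e2_def)
  also have "(LINT x|left.M. e1 x * - d1 x) = - (LINT x|left.M. (d1 x)\<^sup>2) - k * (LINT x|left.M. d1 x)"
  proof -
    have "(LINT x|left.M. e1 x * - d1 x) = (LINT x|left.M. - (d1 x)\<^sup>2 - k * d1 x)"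
      by (rule Bochner_Integration.integral_cong) (simp_all add: d1_def power2_eq_square algebra_simps)
    also have "\<dots> = - (LINT x|left.M. (d1 x)\<^sup>2) - k * (LINT x|left.M. d1 x)"
      using I left.Lsq_square_integrable[OF d1] by simp
    finally show ?thesis .
  qed
  also have "(LINT x|right.M. e2 x * - d2 x) = - (LINT x|right.M. (d2 x)\<^sup>2) - k * (LINT x|right.M. d2 x)"
  proof -
    have "(LINT x|right.M. e2 x * - d2 x) = (LINT x|right.M. - (d2 x)\<^sup>2 - k * d2 x)"
      by (rule Bochner_Integration.integral_cong) (simp_all add: d2_def power2_eq_square algebra_simps)
    also have "\<dots> = - (LINT x|right.M. (d2 x)\<^sup>2) - k * (LINT x|right.M. d2 x)"
      using I right.Lsq_square_integrable[OF d2] by simp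
    finally show ?thesis .
  qed
  also have "- (LINT x|left.M. (d1 x)\<^sup>2) - k * (LINT x|left.M. d1 x) + (- (LINT x|right.M. (d2 x)\<^sup>2) - k * (LINT x|right.M. d2 x))
      = - (LINT x|left.M. (d1 x)\<^sup>2) - (LINT x|right.M. (d2 x)\<^sup>2) - k * ((LINT x|left.M. d1 x) + (LINT x|right.M. d2 x))"
    by (simp add: distrib_left)
  finally have "(LINT x|left.M. (d1 x)\<^sup>2) + (LINT x|right.M. (d2 x)\<^sup>2) \<le> 0"
    unfolding mean by simp
  then have "(LINT x|left.M. (d1 x)\<^sup>2) = 0" "(LINT x|right.M. (d2 x)\<^sup>2) = 0"
    using left.integral_square_nonneg[of d1] right.integral_square_nonneg[of d2] by linarith+
  then have "AE x in left.M. d1 x = 0" "AE x in right.M. d2 x = 0"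
    using left.integral_square_eq_0[OF d1] right.integral_square_eq_0[OF d2] by simp_all
  then have "AE x in left.M. F1 x (D1 u x) = load1 x - (- k)" "AE x in right.M. F2 x (D2 u x) = load2 x - (- k)"
    by (auto simp: d1_def d2_def e1_def e2_def algebra_simps elim: AE_mp)
  with u(1) that[of "- k"] show ?thesis by (simp add: has_flux_def)
qed

text \<open>Once the residual is a multiple of the linear part of \<open>\<theta>\<close>, the inequality sees a test element only
  through its gap, and every gap occurs.\<close>

lemma inequality_iff_scalar:
  assumes u: "u \<in> V a l b" "\<theta> l u \<in> Z"
  shows "(\<forall>v. v \<in> V a l b \<and> \<theta> l v \<in> Z \<longrightarrow>
      c * (\<theta> l v - \<theta> l u) \<le> V_inner a l b (opA a l b F1 F2 u) (v - u) - V_inner a l b (elt_f a l b f1 f2) (v - u))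
    \<longleftrightarrow> (\<exists>s. has_flux u s \<and> (\<forall>r\<in>Z. 0 \<le> (s - c) * (r - \<theta> l u)))" (is "?L \<longleftrightarrow> ?R")
proof
  assume L: ?L
  obtain s where s: "has_flux u s"
    using flux_of_inequality[OF u, of c] L by blast
  have "0 \<le> (s - c) * (r - \<theta> l u)" if "r \<in> Z" for r
  proof -
    obtain v where v: "v \<in> V a l b" "\<theta> l v = r" using \<theta>_surj by blast
    then have "c * (\<theta> l v - \<theta> l u) \<le> s * (\<theta> l v - \<theta> l u)"
      unfolding residual_of_flux[OF s v(1), symmetric] using L that by blast
    then show ?thesis by (simp add: v(2) left_diff_distrib)
  qed
  with s show ?R by blast
next
  assume ?R
  then obtain s where s: "has_flux u s" "\<And>r. r \<in> Z \<Longrightarrow> 0 \<le> (s - c) * (r - \<theta> l u)" by blast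
  show ?L
  proof (intro allI impI)
    fix v assume "v \<in> V a l b \<and> \<theta> l v \<in> Z"
    then have v: "v \<in> V a l b" "\<theta> l v \<in> Z" by auto
    have "0 \<le> (s - c) * (\<theta> l v - \<theta> l u)" by (rule s(2)[OF v(2)])
    then show "c * (\<theta> l v - \<theta> l u) \<le> V_inner a l b (opA a l b F1 F2 u) (v - u) - V_inner a l b (elt_f a l b f1 f2) (v - u)"
      unfolding residual_of_flux[OF s(1) v(1)] left_diff_distrib by simp
  qed
qed

lemma solves_iff_scalar:
  "solves a l b F1 F2 p f1 f2 {v \<in> V a l b. \<theta> l v \<in> Z} u \<longleftrightarrow>
    \<theta> l u \<in> Z \<and> (\<exists>s. has_flux u s \<and> (\<forall>r\<in>Z. 0 \<le> (s - p (\<theta> l u)) * (r - \<theta> l u)))"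
proof (cases "u \<in> V a l b \<and> \<theta> l u \<in> Z")
  case True
  have "V_inner a l b (elt_f a l b f1 f2) w \<le> V_inner a l b (opA a l b F1 F2 u) w + jfun l p u v - jfun l p u u
    \<longleftrightarrow> p (\<theta> l u) * (\<theta> l v - \<theta> l u) \<le> V_inner a l b (opA a l b F1 F2 u) w - V_inner a l b (elt_f a l b f1 f2) w" for v w
    unfolding jfun_def right_diff_distrib by linarith
  with True inequality_iff_scalar[of u Z "p (\<theta> l u)"] show ?thesis
    by (simp add: solves_def del: split_paired_All)
next
  case False
  then show ?thesis by (auto simp: solves_def has_flux_def)
qed

lemma solves_penalized_iff_scalar:
  "solves_penalized a l b F1 F2 p f1 f2 q lam {v \<in> V a l b. \<theta> l v \<in> Z} u \<longleftrightarrow>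
    \<theta> l u \<in> Z \<and> (\<exists>s. has_flux u s \<and>
      (\<forall>r\<in>Z. 0 \<le> (s - (p (\<theta> l u) + q (\<theta> l u) / lam)) * (r - \<theta> l u)))"
proof (cases "u \<in> V a l b \<and> \<theta> l u \<in> Z")
  case True
  have G: "V_inner a l b (opG a l b q u) (v - u) = - q (\<theta> l u) * (\<theta> l v - \<theta> l u)" if "v \<in> V a l b" for v
    using True that V_diff(1)[of v u] by (simp add: inner_G) (simp add: \<theta>_def fun_diff_def algebra_simps)
  have "V_inner a l b (elt_f a l b f1 f2) (v - u) \<le> V_inner a l b (opA a l b F1 F2 u) (v - u)
       + 1 / lam * V_inner a l b (opG a l b q u) (v - u) + jfun l p u v - jfun l p u u
    \<longleftrightarrow> (p (\<theta> l u) + q (\<theta> l u) / lam) * (\<theta> l v - \<theta> l u)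
       \<le> V_inner a l b (opA a l b F1 F2 u) (v - u) - V_inner a l b (elt_f a l b f1 f2) (v - u)" if "v \<in> V a l b" for v
  proof -
    have "1 / lam * V_inner a l b (opG a l b q u) (v - u) = - (q (\<theta> l u) / lam * (\<theta> l v - \<theta> l u))"
      using G[OF that] by simp
    then show ?thesis
      unfolding jfun_def right_diff_distrib distrib_right by linarith
  qed
  with True inequality_iff_scalar[of u Z "p (\<theta> l u) + q (\<theta> l u) / lam"] show ?thesis
    by (simp add: solves_penalized_def del: split_paired_All cong: ball_cong)
next
  case False
  then show ?thesis by (auto simp: solves_penalized_def has_flux_def)
qed

text \<open>Each contact force is realized by solving the constitutive laws pointwise for the strain. In this
  way a cluster point of contact forces gives rise to an element of \<open>V\<close>.\<close>

lemma flux_exists: obtains u where "has_flux u s"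
proof -
  obtain g1 where g1: "g1 \<in> Lsq a (- l)" "AE x in left.M. F1 x (g1 x) = load1 x - s"
    using left.inverse_Lsq[OF left.Lsq_diff[OF load1_Lsq left.Lsq_const]] by blast
  obtain g2 where g2: "g2 \<in> Lsq l b" "AE x in right.M. F2 x (g2 x) = load2 x - s"
    using right.inverse_Lsq[OF right.Lsq_diff[OF load2_Lsq right.Lsq_const]] by blast
  obtain u where u: "u \<in> V a l b" "AE x in left.M. D1 u x = g1 x" "AE x in right.M. D2 u x = g2 x"
    using V_of_derivatives[OF g1(1) g2(1)] by blast
  have "AE x in left.M. F1 x (D1 u x) = load1 x - s" using g1(2) u(2) by eventually_elim simp
  moreover have "AE x in right.M. F2 x (D2 u x) = load2 x - s" using g2(2) u(3) by eventually_elim simp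
  ultimately show ?thesis using u(1) that by (simp add: has_flux_def)
qed

lemma \<theta>_flux_bounds:
  assumes u: "has_flux u s" and u': "has_flux u' s'" and "s \<le> s'"
  shows "((- l - a) / M1 + (b - l) / M2) * (s' - s) \<le> \<theta> l u' - \<theta> l u"
    and "\<theta> l u' - \<theta> l u \<le> ((- l - a) / m1 + (b - l) / m2) * (s' - s)"
proof -
  have V: "u \<in> V a l b" "u' \<in> V a l b"
    and f1: "AE x in left.M. F1 x (D1 u x) = load1 x - s" "AE x in left.M. F1 x (D1 u' x) = load1 x - s'"
    and f2: "AE x in right.M. F2 x (D2 u x) = load2 x - s" "AE x in right.M. F2 x (D2 u' x) = load2 x - s'"
    using u u' by (auto simp: has_flux_def)
  note B1 = left.shifted_flux_integral_bounds[OF D1_Lsq[OF V(1)] D1_Lsq[OF V(2)] f1 assms(3)]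
  note B2 = right.shifted_flux_integral_bounds[OF D2_Lsq[OF V(1)] D2_Lsq[OF V(2)] f2 assms(3)]
  have eq: "(x + y) * (s' - s) = (s' - s) * x + (s' - s) * y" for x y :: real
    by (simp add: algebra_simps)
  show "((- l - a) / M1 + (b - l) / M2) * (s' - s) \<le> \<theta> l u' - \<theta> l u"
    unfolding eq \<theta>_eq[OF V(1)] \<theta>_eq[OF V(2)] using B1(1) B2(1) by linarith
  show "\<theta> l u' - \<theta> l u \<le> ((- l - a) / m1 + (b - l) / m2) * (s' - s)"
    unfolding eq \<theta>_eq[OF V(1)] \<theta>_eq[OF V(2)] using B1(2) B2(2) by linarith
qed

lemma V_norm_flux_bound:
  assumes u: "has_flux u s" and u': "has_flux u' s'"
  shows "V_norm a l b (u - u') \<le> \<bar>s - s'\<bar> * sqrt ((- l - a) / m1\<^sup>2 + (b - l) / m2\<^sup>2)"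
proof -
  have V: "u \<in> V a l b" "u' \<in> V a l b"
    and f1: "AE x in left.M. F1 x (D1 u x) = load1 x - s" "AE x in left.M. F1 x (D1 u' x) = load1 x - s'"
    and f2: "AE x in right.M. F2 x (D2 u x) = load2 x - s" "AE x in right.M. F2 x (D2 u' x) = load2 x - s'"
    using u u' by (auto simp: has_flux_def)
  note D = V_diff[OF V]
  note L1 = D1_Lsq[OF D(1)] left.Lsq_diff[OF D1_Lsq[OF V(1)] D1_Lsq[OF V(2)]]
  note L2 = D2_Lsq[OF D(1)] right.Lsq_diff[OF D2_Lsq[OF V(1)] D2_Lsq[OF V(2)]]
  have "V_inner a l b (u - u') (u - u') = (LINT x|left.M. (D1 u x - D1 u' x)\<^sup>2) + (LINT x|right.M. (D2 u x - D2 u' x)\<^sup>2)"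
    unfolding V_inner_def power2_eq_square
    by (intro arg_cong2[where f = "(+)"]
      left.integral_mult_cong_AE[OF L1(1,2) L1(1,2) D(2) D(2)]
      right.integral_mult_cong_AE[OF L2(1,2) L2(1,2) D(3) D(3)])
  also have "\<dots> \<le> (s - s')\<^sup>2 * ((- l - a) / m1\<^sup>2) + (s - s')\<^sup>2 * ((b - l) / m2\<^sup>2)"
    by (intro add_mono left.shifted_flux_norm_bound[OF D1_Lsq[OF V(1)] D1_Lsq[OF V(2)] f1]
      right.shifted_flux_norm_bound[OF D2_Lsq[OF V(1)] D2_Lsq[OF V(2)] f2])
  also have "\<dots> = (s - s')\<^sup>2 * ((- l - a) / m1\<^sup>2 + (b - l) / m2\<^sup>2)"
    by (simp only: distrib_left)
  finally have "sqrt (V_inner a l b (u - u') (u - u')) \<le> sqrt ((s - s')\<^sup>2 * ((- l - a) / m1\<^sup>2 + (b - l) / m2\<^sup>2))"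
    by (rule real_sqrt_le_mono)
  then show ?thesis by (simp add: V_norm_def real_sqrt_mult)
qed

end

section \<open>Convergence of the penalized solutions\<close>

lemma LIMSEQ_if_unique_cluster_point:
  fixes s :: "nat \<Rightarrow> 'a::metric_space"
  assumes "compact B" and s: "\<And>n. s n \<in> B"
    and cluster: "\<And>r x. strict_mono r \<Longrightarrow> (s \<circ> r) \<longlonglongrightarrow> x \<Longrightarrow> x = L"
  shows "s \<longlonglongrightarrow> L"
proof (rule ccontr)
  assume "\<not> s \<longlonglongrightarrow> L"
  then obtain \<epsilon> where \<epsilon>: "\<epsilon> > 0" "\<not> eventually (\<lambda>n. dist (s n) L < \<epsilon>) sequentially"
    unfolding tendsto_iff by blast
  from this(2) have "infinite {n. \<epsilon> \<le> dist (s n) L}"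
    unfolding cofinite_eq_sequentially[symmetric] eventually_cofinite not_less by simp
  from infinite_enumerate[OF this] obtain r :: "nat \<Rightarrow> nat" where r: "strict_mono r" "\<forall>n. r n \<in> {n. \<epsilon> \<le> dist (s n) L}"
    by blast
  have "\<forall>n. (s \<circ> r) n \<in> B" using s by simp
  then obtain x r' where r': "strict_mono (r' :: nat \<Rightarrow> nat)" "((s \<circ> r) \<circ> r') \<longlonglongrightarrow> x"
    using seq_compactE[OF compact_imp_seq_compact[OF \<open>compact B\<close>]] by blast
  have "x = L"
    using cluster[OF strict_mono_o[OF r(1) r'(1)]] r'(2) by (simp add: comp_assoc)
  with r'(2) have "eventually (\<lambda>n. dist (((s \<circ> r) \<circ> r') n) L < \<epsilon>) sequentially"
    using \<epsilon>(1) unfolding tendsto_iff by blast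
  then obtain n where "dist (((s \<circ> r) \<circ> r') n) L < \<epsilon>"
    unfolding eventually_sequentially by blast
  moreover have "\<epsilon> \<le> dist (s (r (r' n))) L" using r(2) by blast
  ultimately show False by simp
qed

text \<open>The penalization argument for a single real unknown. Testing with \<open>r = c\<close>, where \<open>p\<close> and \<open>q\<close> have
  favourable signs, gives \<open>s n * (c - T (s n)) \<ge> 0\<close>, which traps \<open>s n\<close> between \<open>0\<close> and the point where
  \<open>T = c\<close>. Multiplying by \<open>lam n\<close> and passing to the limit shows that \<open>q\<close> vanishes at \<open>T x\<close>
  for each cluster point \<open>x\<close>. For \<open>r\<close> with \<open>q r = 0\<close> the penalty term has a favourable sign because \<open>q\<close> is decreasing, so the
  limit inequality holds at every cluster point, and uniqueness identifies it with \<open>L\<close>.\<close>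

lemma scalar_penalization_limit:
  fixes T p q :: "real \<Rightarrow> real" and lam s :: "nat \<Rightarrow> real" and \<kappa> C c L :: real
  assumes T_lower: "\<And>x y. x \<le> y \<Longrightarrow> \<kappa> * (y - x) \<le> T y - T x"
    and T_upper: "\<And>x y. x \<le> y \<Longrightarrow> T y - T x \<le> C * (y - x)"
    and \<kappa>: "0 < \<kappa>" and c: "0 \<le> c"
    and p_cont: "continuous_on UNIV p" and p_sign: "\<And>r. 0 \<le> p r * (c - r)"
    and q_cont: "continuous_on UNIV q" and q_sign: "\<And>r. 0 \<le> q r * (c - r)" and q_c: "q c = 0"
    and q_anti: "\<And>r r'. (q r - q r') * (r - r') \<le> 0"
    and lam: "\<And>n. 0 < lam n" "lam \<longlonglongrightarrow> 0"
    and feasible: "\<And>n. 0 \<le> T (s n)"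
    and penalized: "\<And>n r. 0 \<le> r \<Longrightarrow> 0 \<le> (s n - (p (T (s n)) + q (T (s n)) / lam n)) * (r - T (s n))"
    and unique: "\<And>x. 0 \<le> T x \<Longrightarrow> q (T x) = 0 \<Longrightarrow>
      (\<And>r. 0 \<le> r \<Longrightarrow> q r = 0 \<Longrightarrow> 0 \<le> (x - p (T x)) * (r - T x)) \<Longrightarrow> x = L"
  shows "s \<longlonglongrightarrow> L"
proof -
  have T_less: "T x < T y" if "x < y" for x y
  proof -
    have "0 < \<kappa> * (y - x)" using that \<kappa> by simp
    then show ?thesis using T_lower[OF less_imp_le[OF that]] by linarith
  qed
  have T_cont: "continuous_on UNIV T"
  proof (rule lipschitz_imp_continuous_on)
    fix x y
    have *: "\<bar>T y - T x\<bar> \<le> C * \<bar>y - x\<bar>" if "x \<le> y" for x y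
    proof -
      have "T x \<le> T y" using T_less[of x y] that unfolding le_less by blast
      then show ?thesis using T_upper[OF that] that by simp
    qed
    show "\<bar>T x - T y\<bar> \<le> C * \<bar>x - y\<bar>"
    proof (cases "x \<le> y")
      case True
      then show ?thesis using *[OF True] by (simp add: abs_minus_commute)
    next
      case False
      then have "y \<le> x" by simp
      from *[OF this] show ?thesis .
    qed
  qed
  obtain x0 where x0: "T x0 = c"
  proof -
    define d where "d = \<bar>c - T 0\<bar> / \<kappa>"
    have d: "d \<ge> 0" "\<kappa> * d = \<bar>c - T 0\<bar>" using \<kappa> by (simp_all add: d_def)
    have "T (- d) \<le> c" "c \<le> T d"
    proof -
      have "\<kappa> * (0 - - d) \<le> T 0 - T (- d)" "\<kappa> * (d - 0) \<le> T d - T 0"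
        by (rule T_lower; use d in simp)+
      then have "\<bar>c - T 0\<bar> \<le> T 0 - T (- d)" "\<bar>c - T 0\<bar> \<le> T d - T 0"
        unfolding d(2)[symmetric] by simp_all
      then show "T (- d) \<le> c" "c \<le> T d" by linarith+
    qed
    then have "\<exists>x. - d \<le> x \<and> x \<le> d \<and> T x = c"
      using d by (intro IVT' continuous_on_subset[OF T_cont]) auto
    then show ?thesis using that by blast
  qed
  have "s n \<in> {min 0 x0..max 0 x0}" for n
  proof -
    have "0 \<le> q (T (s n)) * (c - T (s n)) / lam n"
      using q_sign lam(1)[of n] by simp
    moreover have "(s n - (p (T (s n)) + q (T (s n)) / lam n)) * (c - T (s n))
        = s n * (c - T (s n)) - p (T (s n)) * (c - T (s n)) - q (T (s n)) * (c - T (s n)) / lam n"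
      by (simp add: algebra_simps)
    ultimately have *: "0 \<le> s n * (c - T (s n))"
      using penalized[OF c, of n] p_sign[of "T (s n)"] by linarith
    have "\<not> max 0 x0 < s n"
    proof
      assume "max 0 x0 < s n"
      then have "0 < s n" "c < T (s n)" using T_less[of x0 "s n"] x0 by auto
      then have "s n * (c - T (s n)) < 0" by (simp add: mult_pos_neg)
      then show False using * by simp
    qed
    moreover have "\<not> s n < min 0 x0"
    proof
      assume "s n < min 0 x0"
      then have "s n < 0" "T (s n) < c" using T_less[of "s n" x0] x0 by auto
      then have "s n * (c - T (s n)) < 0" by (simp add: mult_neg_pos)
      then show False using * by simp
    qed
    ultimately show ?thesis by (simp only: not_less atLeastAtMost_iff)
  qed
  then show ?thesis
  proof (rule LIMSEQ_if_unique_cluster_point[OF compact_Icc])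
    fix r :: "nat \<Rightarrow> nat" and x assume r: "strict_mono r" and conv: "(s \<circ> r) \<longlonglongrightarrow> x"
    define t where "t k = T (s (r k))" for k
    have s_lim: "(\<lambda>k. s (r k)) \<longlonglongrightarrow> x" using conv by (simp add: comp_def)
    have t_lim: "t \<longlonglongrightarrow> T x"
      unfolding t_def by (rule continuous_on_tendsto_compose[OF T_cont s_lim]) auto
    have p_lim: "(\<lambda>k. p (t k)) \<longlonglongrightarrow> p (T x)"
      by (rule continuous_on_tendsto_compose[OF p_cont t_lim]) auto
    have q_lim: "(\<lambda>k. q (t k)) \<longlonglongrightarrow> q (T x)"
      by (rule continuous_on_tendsto_compose[OF q_cont t_lim]) auto
    have lam_lim: "(\<lambda>k. lam (r k)) \<longlonglongrightarrow> 0"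
      using LIMSEQ_subseq_LIMSEQ[OF lam(2) r] by (simp add: comp_def)
    have pen: "q (t k) * (\<rho> - t k) / lam (r k) \<le> (s (r k) - p (t k)) * (\<rho> - t k)" if "0 \<le> \<rho>" for k \<rho>
    proof -
      have "(s (r k) - (p (t k) + q (t k) / lam (r k))) * (\<rho> - t k)
          = (s (r k) - p (t k)) * (\<rho> - t k) - q (t k) * (\<rho> - t k) / lam (r k)"
        by (simp add: left_diff_distrib distrib_right diff_divide_distrib)
      then show ?thesis using penalized[OF that, of "r k"] by (simp add: t_def)
    qed
    show "x = L"
    proof (rule unique)
      show "0 \<le> T x"
        by (rule LIMSEQ_le_const[OF t_lim]) (simp add: t_def feasible)
      have "q (T x) * (c - T x) \<le> 0 * ((x - p (T x)) * (c - T x))"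
      proof (rule LIMSEQ_le)
        show "(\<lambda>k. q (t k) * (c - t k)) \<longlonglongrightarrow> q (T x) * (c - T x)"
          by (intro tendsto_intros q_lim t_lim)
        show "(\<lambda>k. lam (r k) * ((s (r k) - p (t k)) * (c - t k))) \<longlonglongrightarrow> 0 * ((x - p (T x)) * (c - T x))"
          by (intro tendsto_intros lam_lim s_lim p_lim t_lim)
        have "q (t k) * (c - t k) \<le> lam (r k) * ((s (r k) - p (t k)) * (c - t k))" for k
          using pen[OF c, of k] lam(1)[of "r k"] by (simp add: pos_divide_le_eq mult.commute)
        then show "\<exists>N. \<forall>n\<ge>N. q (t n) * (c - t n) \<le> lam (r n) * ((s (r n) - p (t n)) * (c - t n))"
          by blast
      qed
      with q_sign[of "T x"] have "q (T x) * (c - T x) = 0" by simp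
      then show "q (T x) = 0" using q_c by auto
      show "0 \<le> (x - p (T x)) * (\<rho> - T x)" if \<rho>: "0 \<le> \<rho>" "q \<rho> = 0" for \<rho>
      proof (rule LIMSEQ_le_const)
        show "(\<lambda>k. (s (r k) - p (t k)) * (\<rho> - t k)) \<longlonglongrightarrow> (x - p (T x)) * (\<rho> - T x)"
          by (intro tendsto_intros s_lim p_lim t_lim)
        have "0 \<le> (s (r k) - p (t k)) * (\<rho> - t k)" for k
        proof -
          have "0 \<le> q (t k) * (\<rho> - t k)"
            using q_anti[of "t k" \<rho>] \<rho>(2) by (simp add: algebra_simps)
          then have "0 \<le> q (t k) * (\<rho> - t k) / lam (r k)"
            using lam(1)[of "r k"] by simp
          then show ?thesis using pen[OF \<rho>(1), of k] by linarith
        qed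
        then show "\<exists>N. \<forall>n\<ge>N. 0 \<le> (s (r n) - p (t n)) * (\<rho> - t n)" by blast
      qed
    qed
  qed
qed

context gap_problem
begin

text \<open>Common form of the three convergence results: the limit problem is posed on the zero set of the
  penalty inside the original constraint set. A cluster point of the contact forces is the contact
  force of a solution of the limit problem, hence of \<open>w\<close>; and the contact force controls the element
  in norm.\<close>

lemma penalized_solutions_converge:
  fixes p q :: "real \<Rightarrow> real" and lam :: "nat \<Rightarrow> real" and u :: "nat \<Rightarrow> fpair" and w :: fpair
  assumes p_cont: "continuous_on UNIV p" and p_sign: "\<And>r. 0 \<le> p r * (2 * l - r)"
    and q_cont: "continuous_on UNIV q" and q_sign: "\<And>r. 0 \<le> q r * (2 * l - r)" and q_zero: "q (2 * l) = 0"
    and q_anti: "\<And>r r'. (q r - q r') * (r - r') \<le> 0"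
    and lam: "\<And>n. 0 < lam n" "lam \<longlonglongrightarrow> 0"
    and u: "\<And>n. solves_penalized a l b F1 F2 p f1 f2 q (lam n) {v \<in> V a l b. 0 \<le> \<theta> l v} (u n)"
    and w: "is_unique_solution (solves a l b F1 F2 p f1 f2 {v \<in> V a l b. 0 \<le> \<theta> l v \<and> q (\<theta> l v) = 0}) w"
  shows "V_tendsto a l b u w"
proof -
  define T where "T s = \<theta> l (SOME v. has_flux v s)" for s
  define \<kappa> where "\<kappa> = (- l - a) / M1 + (b - l) / M2"
  define C where "C = (- l - a) / m1 + (b - l) / m2"
  let ?Z = "{r. 0 \<le> r \<and> q r = 0}"
  have some: "has_flux (SOME v. has_flux v s) s" for s
    using flux_exists[of s] by (metis someI)
  have \<kappa>: "0 < \<kappa>"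
    unfolding \<kappa>_def using left_length right_length left.K_pos right.K_pos by (intro add_pos_pos divide_pos_pos) auto
  have T_eq: "\<theta> l v = T s" if "has_flux v s" for v s
    using \<theta>_flux_bounds[OF that some[of s]] by (simp add: T_def)
  have T_lower: "\<kappa> * (y - x) \<le> T y - T x" and T_upper: "T y - T x \<le> C * (y - x)" if "x \<le> y" for x y
    using \<theta>_flux_bounds[OF some some that] by (simp_all add: T_def \<kappa>_def C_def)
  have flux_unique: "x = y" if "has_flux v x" "has_flux v y" for v x y
  proof -
    have *: False if "x' < y'" "has_flux v x'" "has_flux v y'" for x' y'
      using T_lower[of x' y'] T_eq[OF that(2)] T_eq[OF that(3)] that(1) \<kappa> mult_pos_pos[of \<kappa> "y' - x'"] by linarith
    then show ?thesis using that by (metis linorder_neqE)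
  qed
  have "\<exists>s. has_flux (u n) s \<and> (\<forall>r\<in>{0..}. 0 \<le> (s - (p (\<theta> l (u n)) + q (\<theta> l (u n)) / lam n)) * (r - \<theta> l (u n)))"
    "0 \<le> \<theta> l (u n)" for n
    using u[of n] solves_penalized_iff_scalar[of p q "lam n" "{0..}" "u n"] by simp_all
  then obtain s where s: "\<And>n. has_flux (u n) (s n)" "\<And>n. 0 \<le> \<theta> l (u n)"
    "\<And>n r. 0 \<le> r \<Longrightarrow> 0 \<le> (s n - (p (\<theta> l (u n)) + q (\<theta> l (u n)) / lam n)) * (r - \<theta> l (u n))"
    by (metis atLeast_iff)
  have solves: "solves a l b F1 F2 p f1 f2 {v \<in> V a l b. 0 \<le> \<theta> l v \<and> q (\<theta> l v) = 0} v \<longleftrightarrow>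
    0 \<le> \<theta> l v \<and> q (\<theta> l v) = 0 \<and> (\<exists>s. has_flux v s \<and> (\<forall>r. 0 \<le> r \<and> q r = 0 \<longrightarrow> 0 \<le> (s - p (\<theta> l v)) * (r - \<theta> l v)))" for v
    using solves_iff_scalar[of p ?Z v] by simp
  obtain L where L: "has_flux w L"
    using w solves by (auto simp: is_unique_solution_def)
  have "s \<longlonglongrightarrow> L"
  proof (rule scalar_penalization_limit[OF T_lower T_upper \<kappa> _ p_cont p_sign q_cont q_sign q_zero q_anti lam])
    show "0 \<le> 2 * l" using l_pos by simp
    show "0 \<le> T (s n)" for n using s(2)[of n] T_eq[OF s(1)[of n]] by simp
    show "0 \<le> (s n - (p (T (s n)) + q (T (s n)) / lam n)) * (r - T (s n))" if "0 \<le> r" for n r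
      using s(3)[OF that, of n] T_eq[OF s(1)[of n]] by simp
    fix x assume x: "0 \<le> T x" "q (T x) = 0"
      "\<And>r. 0 \<le> r \<Longrightarrow> q r = 0 \<Longrightarrow> 0 \<le> (x - p (T x)) * (r - T x)"
    obtain v where v: "has_flux v x" using flux_exists by blast
    have "solves a l b F1 F2 p f1 f2 {v \<in> V a l b. 0 \<le> \<theta> l v \<and> q (\<theta> l v) = 0} v"
      unfolding solves T_eq[OF v] using v x by blast
    then have "v = w" using w unfolding is_unique_solution_def by blast
    with v L flux_unique show "x = L" by blast
  qed
  define B where "B = sqrt ((- l - a) / m1\<^sup>2 + (b - l) / m2\<^sup>2)"
  have lim: "(\<lambda>n. \<bar>s n - L\<bar> * B) \<longlonglongrightarrow> 0"
  proof -
    have "(\<lambda>n. \<bar>s n - L\<bar> * B) \<longlonglongrightarrow> \<bar>L - L\<bar> * B"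
      by (intro tendsto_intros \<open>s \<longlonglongrightarrow> L\<close>)
    then show ?thesis by simp
  qed
  show ?thesis
    unfolding V_tendsto_def
  proof (rule tendsto_sandwich[OF _ _ tendsto_const lim])
    show "\<forall>\<^sub>F n in sequentially. 0 \<le> V_norm a l b (u n - w)"
      by (simp add: V_norm_def V_inner_def add_nonneg_nonneg)
    show "\<forall>\<^sub>F n in sequentially. V_norm a l b (u n - w) \<le> \<bar>s n - L\<bar> * B"
      unfolding B_def by (intro always_eventually allI V_norm_flux_bound s(1) L)
  qed
qed

end

theorem theorem5:
  fixes a l b L1 L2 L m1 M1 m2 M2 Lp Lq :: real
    and F1 F2 :: "real \<Rightarrow> real \<Rightarrow> real"
    and p q f1 f2 :: "real \<Rightarrow> real"
    and lam :: "nat \<Rightarrow> real"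
    and u :: "nat \<Rightarrow> fpair"
    and u' u'' u''' :: fpair
  assumes geometry: "a < - l" "- l < 0" "0 < l" "l < b"
    and L_def: "L1 = - l - a" "L2 = b - l" "L = max L1 L2"
    and F1_meas: "\<And>r. (\<lambda>x. F1 x r) \<in> borel_measurable (lebesgue_on {a<..<- l})"
    and F1_const: "m1 > 0" "M1 > 0"
    and F1_mono: "AE x in lebesgue_on {a<..<- l}. \<forall>r s. (F1 x r - F1 x s) * (r - s) \<ge> m1 * \<bar>r - s\<bar>\<^sup>2"
    and F1_lip: "AE x in lebesgue_on {a<..<- l}. \<forall>r s. \<bar>F1 x r - F1 x s\<bar> \<le> M1 * \<bar>r - s\<bar>"
    and F1_zero: "AE x in lebesgue_on {a<..<- l}. F1 x 0 = 0"
    and F2_meas: "\<And>r. (\<lambda>x. F2 x r) \<in> borel_measurable (lebesgue_on {l<..<b})"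
    and F2_const: "m2 > 0" "M2 > 0"
    and F2_mono: "AE x in lebesgue_on {l<..<b}. \<forall>r s. (F2 x r - F2 x s) * (r - s) \<ge> m2 * \<bar>r - s\<bar>\<^sup>2"
    and F2_lip: "AE x in lebesgue_on {l<..<b}. \<forall>r s. \<bar>F2 x r - F2 x s\<bar> \<le> M2 * \<bar>r - s\<bar>"
    and F2_zero: "AE x in lebesgue_on {l<..<b}. F2 x 0 = 0"
    and p_lip: "Lp > 0" "\<And>r1 r2. \<bar>p r1 - p r2\<bar> \<le> Lp * \<bar>r1 - r2\<bar>"
    and p_sign: "\<And>r. r < 2 * l \<Longrightarrow> p r > 0" "\<And>r. r > 2 * l \<Longrightarrow> p r < 0"
    and small: "m1 + m2 > 2 * Lp * L"
    and f_L2: "f1 \<in> Lsq a (- l)" "f2 \<in> Lsq l b"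
    and q_lip: "Lq > 0" "\<And>r1 r2. \<bar>q r1 - q r2\<bar> \<le> Lq * \<bar>r1 - r2\<bar>"
    and q_mono: "\<And>r1 r2. (q r1 - q r2) * (r1 - r2) \<le> 0"
    and q_sign: "\<And>r. r \<le> 2 * l \<Longrightarrow> q r \<ge> 0" "\<And>r. r \<ge> 2 * l \<Longrightarrow> q r \<le> 0"
    and lam: "\<And>n. lam n > 0" "lam \<longlonglongrightarrow> 0"
    and u: "\<And>n. is_unique_solution (solves_penalized a l b F1 F2 p f1 f2 q (lam n) (K0 a l b)) (u n)"
    and u': "is_unique_solution (solves a l b F1 F2 p f1 f2 (K1 a l b)) u'"
    and u'': "is_unique_solution (solves a l b F1 F2 p f1 f2 (K2 a l b)) u''"
    and u''': "is_unique_solution (solves a l b F1 F2 p f1 f2 (K3 a l b)) u'''"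
  shows "((\<forall>r. q r = 0 \<longleftrightarrow> r \<ge> 2 * l) \<longrightarrow> V_tendsto a l b u u') \<and>
         ((\<forall>r. q r = 0 \<longleftrightarrow> r \<le> 2 * l) \<longrightarrow> V_tendsto a l b u u'') \<and>
         ((\<forall>r. q r = 0 \<longleftrightarrow> r = 2 * l) \<longrightarrow> V_tendsto a l b u u''')"
proof -
  interpret gap_problem a l b F1 m1 M1 F2 m2 M2 f1 f2
    by unfold_locales (fact assms)+
  have p_prod: "0 \<le> p r * (2 * l - r)" for r
  proof (cases r "2 * l" rule: linorder_cases)
    case less
    then show ?thesis using p_sign(1)[OF less] by simp
  next
    case greater
    then show ?thesis using p_sign(2)[OF greater] by (simp add: mult_nonpos_nonpos)
  qed simp
  have q_prod: "0 \<le> q r * (2 * l - r)" for r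
  proof (cases "r \<le> 2 * l")
    case True
    then show ?thesis using q_sign(1)[OF True] by simp
  next
    case False
    then show ?thesis using q_sign(2)[of r] by (simp add: mult_nonpos_nonpos)
  qed
  have q_zero: "q (2 * l) = 0"
    using q_sign(1)[of "2 * l"] q_sign(2)[of "2 * l"] by simp
  have pen: "solves_penalized a l b F1 F2 p f1 f2 q (lam n) {v \<in> V a l b. 0 \<le> \<theta> l v} (u n)" for n
    using u[of n] by (simp add: is_unique_solution_def K0_def)
  have conv: "V_tendsto a l b u w"
    if "is_unique_solution (solves a l b F1 F2 p f1 f2 {v \<in> V a l b. 0 \<le> \<theta> l v \<and> q (\<theta> l v) = 0}) w" for w
    by (rule penalized_solutions_converge[OF lipschitz_imp_continuous_on[OF p_lip(2)] p_prod
          lipschitz_imp_continuous_on[OF q_lip(2)] q_prod q_zero q_mono lam pen that])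
  show ?thesis
  proof (intro conjI impI)
    assume q: "\<forall>r. q r = 0 \<longleftrightarrow> r \<ge> 2 * l"
    have "K1 a l b = {v \<in> V a l b. 0 \<le> \<theta> l v \<and> q (\<theta> l v) = 0}"
      using q geometry(3) by (auto simp: K1_def)
    with u' show "V_tendsto a l b u u'" by (intro conv) simp
  next
    assume q: "\<forall>r. q r = 0 \<longleftrightarrow> r \<le> 2 * l"
    have "K2 a l b = {v \<in> V a l b. 0 \<le> \<theta> l v \<and> q (\<theta> l v) = 0}"
      using q by (auto simp: K2_def)
    with u'' show "V_tendsto a l b u u''" by (intro conv) simp
  next
    assume q: "\<forall>r. q r = 0 \<longleftrightarrow> r = 2 * l"
    have "K3 a l b = {v \<in> V a l b. 0 \<le> \<theta> l v \<and> q (\<theta> l v) = 0}"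
      using q geometry(3) by (auto simp: K3_def)
    with u''' show "V_tendsto a l b u u'''" by (intro conv) simp
  qed
qed

end
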